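(* Let $K$ be an infinite Dirichlet field of positive characteristic, and let $h$ be a self-homeomorphism of the Golomb space $G(K[X])$. Then there are a unit $u\in K\setminus\{0\}$ and a ring automorphism $\sigma$ of $K[X]$ such that $h(f)=u\,\sigma(f)$ for every $f\in K[X]\setminus\{0\}$.
   Context: For an integral domain $R$ (commutative unitary ring without zero-divisors), write $R^\bullet := R\setminus\{0\}$. The Golomb space $G(R)$ is the topological space with underlying set $R^\bullet$ whose topology (the Golomb topology) is generated by the sets $(a+I)\cap R^\bullet$, where $a\in R^\bullet$ and $I$ is a nonzero ideal of $R$ with $\langle a, I\rangle = R$. A field $K$ is called Dirichlet if the set of irreducible elements of the one-variable polynomial ring $K[X]$ is dense in $G(K[X])$. *)

theory Defs
  imports "HOL-Analysis.Analysis" "HOL-Computational_Algebra.Computational_Algebra"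
begin

text \<open>A commutative ring as a module over itself: \<open>ring_ideal.subspace I\<close> says that \<open>I\<close> is an ideal,
  and \<open>ring_ideal.span S\<close> is the ideal generated by \<open>S\<close>.\<close>

global_interpretation ring_ideal: module "times :: 'a::comm_ring_1 \<Rightarrow> 'a \<Rightarrow> 'a"
  by standard (simp_all add: algebra_simps)

definition golomb_space :: "'a::idom topology" where
  "golomb_space = topology_generated_by
     {(+) a ` I \<inter> (UNIV - {0}) | a I.
        a \<noteq> 0 \<and> ring_ideal.subspace I \<and> I \<noteq> {0} \<and> ring_ideal.span (insert a I) = UNIV}"

lemma topspace_golomb_space: "topspace (golomb_space :: 'a::idom topology) = UNIV - {0}"
proof -
  have "x \<in> topspace (golomb_space :: 'a topology)" if "x \<noteq> 0" for x :: 'a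
  proof -
    have U: "(+) x ` UNIV \<inter> (UNIV - {0}) = UNIV - {0}"
      by simp
    have "(UNIV :: 'a set) \<noteq> {0}"
      by (metis UNIV_I singletonD zero_neq_one)
    then show ?thesis
      using that U unfolding golomb_space_def topology_generated_by_topspace
      by (intro UnionI[of "UNIV - {0}"] CollectI exI[of _ x] exI[of _ UNIV])
         (auto simp: ring_ideal.subspace_UNIV ring_ideal.span_UNIV insert_absorb)
  qed
  then show ?thesis
    unfolding golomb_space_def topology_generated_by_topspace by blast
qed

text \<open>The property of the field given by the type \<open>'a\<close>.\<close>

definition dirichlet_field :: "'a::field itself \<Rightarrow> bool" where
  "dirichlet_field _ \<longleftrightarrow>
     golomb_space closure_of {p :: 'a poly. irreducible p} = topspace golomb_space"

definition ring_automorphism :: "('a::ring_1 \<Rightarrow> 'a) \<Rightarrow> bool" where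
  "ring_automorphism \<sigma> \<longleftrightarrow>
     bij \<sigma> \<and> \<sigma> 1 = 1 \<and> (\<forall>x y. \<sigma> (x + y) = \<sigma> x + \<sigma> y) \<and> (\<forall>x y. \<sigma> (x * y) = \<sigma> x * \<sigma> y)"

end

theory Submission
  imports Defs
begin

text \<open>Closures of open sets in the Golomb topology are so large that the filters they generate
  depend only on divisibility by primes and on congruences. This lets a self-homeomorphism \<open>h\<close>
  recognize the units and the inclusion of sets of prime divisors, so that it induces a bijection
  \<open>q \<mapsto> g\<close> of the irreducible polynomials (up to units) such that \<open>q\<close> divides \<open>x\<close> if and only if
  \<open>g\<close> divides \<open>h x\<close>; moreover \<open>h\<close> is continuous from the \<open>q\<close>-adic to the \<open>g\<close>-adic topology
  outside \<open>q\<close>.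

  The key step is that \<open>q dvd z - c\<close> implies \<open>g dvd h z - h c\<close> for constants \<open>c\<close>. Take another
  irreducible \<open>q'\<close>, corresponding to \<open>g'\<close>, and an irreducible \<open>f\<close> close to \<open>z\<close> at \<open>q\<close> and close
  to \<open>c\<close> at \<open>q'\<close>. Since \<open>h f\<close> is congruent to the constant \<open>d = h c\<close> modulo \<open>g'\<close>, the powers
  \<open>(h f / d) ^ (p ^ E)\<close> tend to 1 at \<open>g'\<close>. Their preimages are constants times powers \<open>f ^ n\<close>, and
  they converge at \<open>q'\<close>, which forces \<open>n\<close> to tend to 0 in the \<open>p\<close>-adic integers; but then they
  converge at \<open>q\<close> as well. Hence the powers also tend to 1 at \<open>g\<close>, that is,
  \<open>g dvd h f - d\<close>.

  Consequently linear polynomials correspond to linear ones, which yields bijections \<open>\<phi>\<close> and \<open>\<sigma>\<close>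
  of the field such that \<open>h z\<close>, as a function, is \<open>\<sigma> \<circ> z \<circ> \<phi>\<^sup>-\<^sup>1\<close>. Then conjugation by \<open>\<phi>\<close> preserves
  polynomial functions, hence also the invertible ones, which are the affine maps. Applied to
  translations and homotheties, this shows that \<open>\<sigma>\<close> is a scalar multiple of a field
  automorphism.\<close>

subsection \<open>Comaximal elements and irreducible polynomials\<close>

text \<open>Read as a module law, associativity is a simplification rule in the direction opposite to
  the one of \<open>ac_simps\<close>.\<close>

declare ring_ideal.scale_scale [simp del]

text \<open>Stands in for the ideal condition on basic sets: by
  \<open>golomb_basis_contains_coset\<close>, principal moduli suffice.\<close>

definition comaximal :: "'a::comm_ring_1 \<Rightarrow> 'a \<Rightarrow> bool" where
  "comaximal a b \<longleftrightarrow> (\<exists>s t. s * a + t * b = 1)"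

lemma comaximal_commute: "comaximal a b \<longleftrightarrow> comaximal b a"
  unfolding comaximal_def by (metis add.commute)

lemma comaximal_mult_right:
  assumes "comaximal a b" "comaximal a c"
  shows "comaximal a (b * c)"
proof -
  obtain s t u v where "s * a + t * b = 1" "u * a + v * c = 1"
    using assms unfolding comaximal_def by blast
  moreover have "(s * u * a + s * v * c + t * b * u) * a + (t * v) * (b * c)
      = (s * a + t * b) * (u * a + v * c)"
    by (simp add: algebra_simps)
  ultimately have "(s * u * a + s * v * c + t * b * u) * a + (t * v) * (b * c) = 1"
    by simp
  then show ?thesis unfolding comaximal_def by blast
qed

lemma comaximal_mult_left:
  "comaximal a c \<Longrightarrow> comaximal b c \<Longrightarrow> comaximal (a * b) c"
  using comaximal_mult_right[of c a b] by (simp add: comaximal_commute)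

lemma comaximal_1_left [simp]: "comaximal 1 a"
  unfolding comaximal_def by (rule exI[of _ 1], rule exI[of _ 0]) simp

lemma comaximal_power_left: "comaximal a b \<Longrightarrow> comaximal (a ^ n) b"
  by (induction n) (auto intro: comaximal_mult_left)

lemma comaximal_dvd_right:
  assumes "comaximal a b" "c dvd b"
  shows "comaximal a c"
proof -
  obtain s t k where "s * a + t * b = 1" "b = c * k"
    using assms unfolding comaximal_def dvd_def by auto
  then have "s * a + (t * k) * c = 1" by (simp add: ac_simps)
  then show ?thesis unfolding comaximal_def by blast
qed

lemma comaximal_dvd_left: "comaximal a b \<Longrightarrow> c dvd a \<Longrightarrow> comaximal c b"
  using comaximal_dvd_right[of b a c] by (simp add: comaximal_commute)

lemma comaximal_dvd_mult:
  assumes "comaximal a b" "a dvd b * c"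
  shows "a dvd c"
proof -
  obtain s t where "s * a + t * b = 1"
    using assms unfolding comaximal_def by blast
  moreover have "c = a * (s * c) + t * (b * c) - (s * a + t * b - 1) * c"
    by (simp add: algebra_simps)
  ultimately have "c = a * (s * c) + t * (b * c)" by simp
  moreover have "a dvd a * (s * c) + t * (b * c)"
    by (rule dvd_add[OF dvd_triv_left dvd_mult[OF assms(2)]])
  ultimately show ?thesis by simp
qed

lemma comaximal_common_dvd_unit: "comaximal a b \<Longrightarrow> d dvd a \<Longrightarrow> d dvd b \<Longrightarrow> d dvd 1"
  unfolding comaximal_def by (metis dvd_add dvd_mult)

lemma comaximal_add_mult: "comaximal a b \<Longrightarrow> b dvd c - a \<Longrightarrow> comaximal c b"
proof -
  assume "comaximal a b" "b dvd c - a"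
  then obtain s t k where "s * a + t * b = 1" "c - a = b * k"
    unfolding comaximal_def dvd_def by blast
  have "s * c + (t - s * k) * b = s * a + t * b + s * (c - a - b * k)"
    by (simp add: algebra_simps)
  then have "s * c + (t - s * k) * b = 1"
    using \<open>s * a + t * b = 1\<close> \<open>c - a = b * k\<close> by simp
  then show "comaximal c b"
    unfolding comaximal_def by blast
qed

lemma comaximal_diff_unit: "v dvd 1 \<Longrightarrow> comaximal (x::'a::comm_ring_1) (x - v)"
proof -
  assume "v dvd 1"
  then obtain k where "1 = v * k" by (auto simp: dvd_def)
  then have "k * x + (- k) * (x - v) = 1" by (simp add: algebra_simps)
  then show ?thesis unfolding comaximal_def by blast
qed

lemma comaximal_unit_left: "x dvd 1 \<Longrightarrow> comaximal x r"
  by (rule comaximal_dvd_left[OF comaximal_1_left])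

lemma chinese_remainder_comaximal:
  fixes m n a b :: "'a::comm_ring_1"
  assumes "comaximal m n"
  obtains w where "m dvd w - a" "n dvd w - b"
proof -
  obtain s t where st: "s * m + t * n = 1"
    using assms unfolding comaximal_def by blast
  define w where "w = a * (t * n) + b * (s * m)"
  have "w - a = m * (s * (b - a)) + a * (s * m + t * n - 1)"
    unfolding w_def by (simp add: algebra_simps)
  moreover have "w - b = n * (t * (a - b)) + b * (s * m + t * n - 1)"
    unfolding w_def by (simp add: algebra_simps)
  ultimately have "m dvd w - a" "n dvd w - b" using st by simp_all
  then show ?thesis by (rule that)
qed

section \<open>Bezout identity and prime divisors in K[X]\<close>

lemma bezout_poly:
  fixes a b :: "'a::field poly"
  shows "\<exists>d s t. d = s * a + t * b \<and> d dvd a \<and> d dvd b"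
proof (induction "euclidean_size b" arbitrary: a b rule: less_induct)
  case less
  show ?case
  proof (cases "b = 0")
    case True
    then show ?thesis
      by (intro exI[of _ a] exI[of _ 1] exI[of _ 0]) simp
  next
    case False
    then obtain d s t where d: "d = s * b + t * (a mod b)" "d dvd b" "d dvd a mod b"
      using less[of "a mod b" b] mod_size_less by blast
    have "d = t * a + (s - t * (a div b)) * b"
      using d(1) by (simp add: algebra_simps minus_div_mult_eq_mod[symmetric])
    then show ?thesis
      using d dvd_mod_imp_dvd by blast
  qed
qed

lemma irreducible_dvd_exists:
  fixes a :: "'a::field poly"
  assumes "a \<noteq> 0" "\<not> a dvd 1"
  shows "\<exists>p. irreducible p \<and> p dvd a"
  using assms
proof (induction "degree a" arbitrary: a rule: less_induct)
  case less
  show ?case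
  proof (cases "irreducible a")
    case False
    then obtain b c where bc: "a = b * c" "\<not> b dvd 1" "\<not> c dvd 1"
      using less.prems unfolding irreducible_def by blast
    then have nz: "b \<noteq> 0" "c \<noteq> 0" using less.prems by auto
    then have "degree c > 0"
      using bc(3) by (metis bot_nat_0.not_eq_extremum is_unit_iff_degree)
    then have "degree b < degree a"
      using nz bc(1) by (simp add: degree_mult_eq)
    then show ?thesis
      using less.hyps[of b] nz bc by (meson dvd_mult2)
  qed auto
qed

lemma comaximal_polyI:
  fixes a b :: "'a::field poly"
  assumes "a \<noteq> 0 \<or> b \<noteq> 0" "\<And>p. irreducible p \<Longrightarrow> p dvd a \<Longrightarrow> p dvd b \<Longrightarrow> False"
  shows "comaximal a b"
proof -
  obtain d s t where d: "d = s * a + t * b" "d dvd a" "d dvd b"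
    using bezout_poly by blast
  have "d \<noteq> 0" using d assms(1) by auto
  then have "d dvd 1"
    using irreducible_dvd_exists[of d] assms(2) d by (meson dvd_trans)
  then obtain k where "1 = d * k" by (auto simp: dvd_def)
  then have "(k * s) * a + (k * t) * b = 1" using d(1) by (simp add: algebra_simps)
  then show ?thesis unfolding comaximal_def by blast
qed

lemma irreducible_comaximal_iff:
  fixes p x :: "'a::field poly"
  assumes "irreducible p"
  shows "comaximal p x \<longleftrightarrow> \<not> p dvd x"
proof
  show "comaximal p x \<Longrightarrow> \<not> p dvd x"
    using irreducible_not_unit[OF assms] comaximal_common_dvd_unit[of p x p] by auto
next
  assume np: "\<not> p dvd x"
  show "comaximal p x"
  proof (rule comaximal_polyI)
    fix q assume q: "irreducible q" "q dvd p" "q dvd x"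
    then have "p dvd q"
      using irreducibleD'[OF assms q(2)] irreducible_not_unit[OF q(1)] by simp
    then show False using np q dvd_trans by blast
  qed (use assms in auto)
qed

lemma irreducible_dvd_mult_poly:
  fixes p :: "'a::field poly"
  assumes "irreducible p"
  shows "p dvd a * b \<longleftrightarrow> p dvd a \<or> p dvd b"
  using comaximal_dvd_mult[of p a b] irreducible_comaximal_iff[OF assms, of a] by auto

lemma irreducible_dvd_power_poly:
  fixes p :: "'a::field poly"
  assumes "irreducible p"
  shows "p dvd a ^ n \<Longrightarrow> p dvd a"
  by (induction n) (use assms irreducible_not_unit in \<open>auto simp: irreducible_dvd_mult_poly\<close>)

lemma irreducible_power_decompose:
  fixes p m :: "'a::field poly"
  assumes "irreducible p" "m \<noteq> 0"
  obtains e m' where "m = p ^ e * m'" "\<not> p dvd m'"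
proof -
  have "\<exists>e m'. m = p ^ e * m' \<and> \<not> p dvd m'"
    using assms(2)
  proof (induction "degree m" arbitrary: m rule: less_induct)
    case less
    show ?case
    proof (cases "p dvd m")
      case True
      then obtain k where k: "m = p * k" by (auto simp: dvd_def)
      have "degree p > 0"
        using assms(1) by (metis bot_nat_0.not_eq_extremum irreducible_def is_unit_iff_degree)
      then have "degree k < degree m" "k \<noteq> 0"
        using k less.prems by (auto simp: degree_mult_eq)
      then obtain e m' where "k = p ^ e * m'" "\<not> p dvd m'"
        using less.hyps[of k] by blast
      then show ?thesis using k by (metis mult.assoc power_Suc)
    next
      case False
      moreover have "m = p ^ 0 * m" by simp
      ultimately show ?thesis by blast
    qed
  qed
  then show ?thesis using that by blast
qed

subsection \<open>Cosets in the Golomb topology\<close>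

definition coset :: "'a::idom \<Rightarrow> 'a \<Rightarrow> 'a set" where
  "coset a r = {v. v \<noteq> 0 \<and> r dvd v - a}"

lemma openin_coset:
  assumes "a \<noteq> 0" "r \<noteq> 0" "comaximal a r"
  shows "openin golomb_space (coset a r)"
proof -
  have sub: "ring_ideal.subspace {x. r dvd x}"
    by (rule ring_ideal.subspaceI) (auto intro: dvd_add dvd_mult)
  obtain s t where st: "s * a + t * r = 1"
    using assms(3) unfolding comaximal_def by blast
  have "s * a + t * r \<in> ring_ideal.span (insert a ({x. r dvd x}))"
    by (intro ring_ideal.span_add ring_ideal.span_scale ring_ideal.span_base)
       auto
  then have "1 \<in> ring_ideal.span (insert a ({x. r dvd x}))"
    by (simp only: st)
  then have "x * 1 \<in> ring_ideal.span (insert a ({x. r dvd x}))" for x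
    by (rule ring_ideal.span_scale)
  then have span: "ring_ideal.span (insert a ({x. r dvd x})) = UNIV" by auto
  have "r \<in> {x. r dvd x}" by simp
  then have ne: "{x. r dvd x} \<noteq> {0}" using assms(2) by blast
  have eq: "coset a r = (+) a ` {x. r dvd x} \<inter> (UNIV - {0})"
  proof (intro set_eqI iffI)
    fix x assume "x \<in> coset a r"
    then show "x \<in> (+) a ` {x. r dvd x} \<inter> (UNIV - {0})"
      by (intro IntI image_eqI[of _ _ "x - a"]) (auto simp: coset_def)
  qed (auto simp: coset_def)
  show ?thesis
    unfolding golomb_space_def eq
    by (intro topology_generated_by_Basis) (use assms sub span ne in blast)
qed

text \<open>Some \<open>1 - k * x\<close> lies in \<open>I\<close> and is comaximal to
  \<open>x\<close>. It serves as the modulus unless it vanishes; then \<open>x\<close> is a unit and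
  any nonzero element of \<open>I\<close> will do.\<close>

lemma golomb_basis_contains_coset:
  fixes a x :: "'a::idom"
  assumes "ring_ideal.subspace I" "I \<noteq> {0}" "ring_ideal.span (insert a I) = UNIV"
    and "x \<in> (+) a ` I"
  shows "\<exists>r. r \<noteq> 0 \<and> comaximal x r \<and> coset x r \<subseteq> (+) a ` I"
proof -
  obtain i where i: "i \<in> I" "x = a + i" using assms(4) by blast
  have "(1::'a) \<in> ring_ideal.span (insert a I)" using assms(3) by simp
  moreover have "ring_ideal.span I = I"
    using assms(1) by (simp add: ring_ideal.span_eq_iff)
  ultimately obtain k where "1 - k * a \<in> I"
    unfolding ring_ideal.span_insert by auto
  then have "(1 - k * a) - k * i \<in> I"
    using assms(1) i by (blast intro: ring_ideal.subspace_diff ring_ideal.subspace_scale)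
  then have j: "1 - k * x \<in> I" using i by (simp add: algebra_simps)
  have "\<exists>r\<in>I. r \<noteq> 0 \<and> comaximal x r"
  proof (cases "1 - k * x = 0")
    case True
    then have "x dvd 1" by (metis dvd_triv_right eq_iff_diff_eq_0)
    moreover have "\<exists>r\<in>I. r \<noteq> 0"
      using assms(1,2) ring_ideal.subspace_0 by blast
    ultimately show ?thesis using comaximal_unit_left by blast
  next
    case False
    have "k * x + 1 * (1 - k * x) = 1" by simp
    then show ?thesis using j False unfolding comaximal_def by blast
  qed
  then obtain r where r: "r \<in> I" "r \<noteq> 0" "comaximal x r" by blast
  have "coset x r \<subseteq> (+) a ` I"
  proof
    fix v assume "v \<in> coset x r"
    then obtain m where "v - x = r * m" by (auto simp: coset_def dvd_def)
    then have "v = a + (i + m * r)" using i by (simp add: algebra_simps)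
    moreover have "i + m * r \<in> I"
      using assms(1) i r by (blast intro: ring_ideal.subspace_add ring_ideal.subspace_scale)
    ultimately show "v \<in> (+) a ` I" by blast
  qed
  then show ?thesis using r by blast
qed

lemma openin_golomb_space_iff:
  fixes U :: "'a::idom set"
  shows "openin golomb_space U \<longleftrightarrow>
    0 \<notin> U \<and> (\<forall>x\<in>U. \<exists>r. r \<noteq> 0 \<and> comaximal x r \<and> coset x r \<subseteq> U)" (is "_ \<longleftrightarrow> ?R U")
proof
  assume U: "openin golomb_space U"
  then have "0 \<notin> U"
    using openin_subset[OF U] by (auto simp: topspace_golomb_space)
  moreover have "\<forall>x\<in>U. \<exists>r. r \<noteq> 0 \<and> comaximal x r \<and> coset x r \<subseteq> U"
    using openin_topology_generated_by[OF U[unfolded golomb_space_def]]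
  proof (induction rule: generate_topology_on.induct)
    case (Int a b)
    show ?case
    proof
      fix x assume x: "x \<in> a \<inter> b"
      obtain r where r: "r \<noteq> 0" "comaximal x r" "coset x r \<subseteq> a" using Int x by blast
      obtain s where s: "s \<noteq> 0" "comaximal x s" "coset x s \<subseteq> b" using Int x by blast
      have "coset x (r * s) \<subseteq> a \<inter> b"
        using r(3) s(3) by (auto simp: coset_def dest: dvd_mult_left dvd_mult_right)
      then show "\<exists>r. r \<noteq> 0 \<and> comaximal x r \<and> coset x r \<subseteq> a \<inter> b"
        using r s by (intro exI[of _ "r * s"]) (auto intro: comaximal_mult_right)
    qed
  next
    case (UN K)
    then show ?case by (meson Sup_upper UnionE subset_trans)
  next
    case (Basis s)
    then obtain a I where I: "s = (+) a ` I \<inter> (UNIV - {0})" "a \<noteq> 0" "ring_ideal.subspace I"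
      "I \<noteq> {0}" "ring_ideal.span (insert a I) = UNIV" by blast
    show ?case
    proof
      fix x assume "x \<in> s"
      then obtain r where "r \<noteq> 0" "comaximal x r" "coset x r \<subseteq> (+) a ` I"
        using golomb_basis_contains_coset[OF I(3-5), of x] I(1) by blast
      moreover have "0 \<notin> coset x r" by (simp add: coset_def)
      ultimately show "\<exists>r. r \<noteq> 0 \<and> comaximal x r \<and> coset x r \<subseteq> s"
        using I(1) by blast
    qed
  qed auto
  ultimately show "?R U" by blast
next
  assume R: "?R U"
  show "openin golomb_space U"
  proof (subst openin_subopen, intro ballI)
    fix x assume x: "x \<in> U"
    then obtain r where r: "r \<noteq> 0" "comaximal x r" "coset x r \<subseteq> U" using R by blast
    have "x \<noteq> 0" using x R by blast
    then show "\<exists>T. openin golomb_space T \<and> x \<in> T \<and> T \<subseteq> U"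
      using r openin_coset[of x r] by (intro exI[of _ "coset x r"]) (auto simp: coset_def)
  qed
qed

text \<open>A neighbourhood of \<open>w\<close> has a modulus \<open>m\<close> comaximal to
  \<open>w\<close>, hence to \<open>s\<close>, whose primes all divide \<open>w\<close>. So the
  Chinese remainder theorem finds a point congruent to \<open>w\<close> modulo \<open>m * r\<close>
  and to \<open>a\<close> modulo \<open>s\<close>.\<close>

lemma in_closure_of_coset_if:
  fixes w a r s :: "'a::field poly"
  assumes "w \<noteq> 0" "r \<noteq> 0" "s \<noteq> 0" "comaximal r s" "r dvd w - a"
    and "\<And>p. irreducible p \<Longrightarrow> p dvd s \<Longrightarrow> p dvd w"
  shows "w \<in> golomb_space closure_of coset a (r * s)"
  unfolding in_closure_of
proof (intro conjI allI impI)
  show "w \<in> topspace golomb_space" using assms(1) by (simp add: topspace_golomb_space)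
next
  fix T assume T: "w \<in> T \<and> openin golomb_space T"
  then obtain m where m: "m \<noteq> 0" "comaximal w m" "coset w m \<subseteq> T"
    unfolding openin_golomb_space_iff by blast
  have "comaximal m s"
  proof (rule comaximal_polyI)
    fix p assume p: "irreducible p" "p dvd m" "p dvd s"
    show False
      using comaximal_common_dvd_unit[OF m(2) assms(6)[OF p(1,3)] p(2)] irreducible_not_unit[OF p(1)]
      by simp
  qed (use assms in auto)
  then obtain v where v: "m * r dvd v - w" "s dvd v - a"
    using chinese_remainder_comaximal comaximal_mult_left[OF _ assms(4)] by blast
  \<comment> \<open>Zero is not a point of the space, so it is replaced by a nonzero element of the
    same residue classes.\<close>
  define v' where "v' = (if v = 0 then m * r * s else v)"
  have "v' \<noteq> 0" using m assms by (simp add: v'_def)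
  have v': "m * r dvd v' - w" "s dvd v' - a"
    using v by (auto simp: v'_def mult.assoc dvd_diff_commute[of _ 0] intro: dvd_diff)
  have "r dvd (v' - w) + (w - a)"
    using v'(1) assms(5) by (intro dvd_add) (auto dest: dvd_mult_right)
  then have "r dvd v' - a" by simp
  moreover from this obtain k where k: "v' - a = r * k" by (auto simp: dvd_def)
  then have "s dvd k"
    using comaximal_dvd_mult[of s r k] v'(2) assms(4) comaximal_commute by metis
  then have "r * s dvd v' - a" using k by (simp add: mult_dvd_mono)
  then have "v' \<in> coset a (r * s)" using \<open>v' \<noteq> 0\<close> by (simp add: coset_def)
  moreover have "v' \<in> T"
    using m(3) v'(1) \<open>v' \<noteq> 0\<close> by (auto simp: coset_def dest: dvd_mult_left)
  ultimately show "\<exists>y. y \<in> coset a (r * s) \<and> y \<in> T" by blast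
qed

text \<open>A partial converse: a modulus \<open>n\<close> comaximal to \<open>w\<close> gives an
  open coset of \<open>w\<close>, which must meet \<open>coset a r\<close>.\<close>

lemma dvd_diff_if_in_closure_of_coset:
  fixes w a r n :: "'a::idom"
  assumes "w \<in> golomb_space closure_of coset a r" "n \<noteq> 0" "n dvd r" "comaximal w n"
  shows "n dvd w - a"
proof -
  have w: "w \<noteq> 0"
    using assms(1) by (auto simp: in_closure_of topspace_golomb_space)
  then have "openin golomb_space (coset w n)" "w \<in> coset w n"
    using openin_coset assms by (auto simp: coset_def)
  then obtain v where "v \<in> coset a r" "v \<in> coset w n"
    using assms(1) unfolding in_closure_of by blast
  then have "n dvd v - a" "n dvd v - w"
    using dvd_trans[OF assms(3), of "v - a"] by (simp_all add: coset_def)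
  then have "n dvd (v - a) - (v - w)" by (rule dvd_diff)
  then show ?thesis by simp
qed

subsection \<open>Divisibility by primes is a topological notion\<close>

definition closure_filter :: "'a topology \<Rightarrow> 'a \<Rightarrow> 'a \<Rightarrow> 'a set \<Rightarrow> bool" where
  "closure_filter T x y W \<longleftrightarrow> (\<exists>U V. openin T U \<and> openin T V \<and> x \<in> U \<and> y \<in> V \<and>
     T closure_of U \<inter> T closure_of V \<subseteq> W)"

text \<open>Together with some other point, \<open>x\<close> has the largest of all closure filters.
  In the Golomb space of K[X] with K infinite, such points are the units.\<close>

definition supercentral :: "'a topology \<Rightarrow> 'a \<Rightarrow> bool" where
  "supercentral T x \<longleftrightarrow> x \<in> topspace T \<and> (\<exists>y. y \<in> topspace T \<and> y \<noteq> x \<and>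
     (\<forall>W a b. closure_filter T a b W \<longrightarrow> closure_filter T x y W))"

text \<open>The points \<open>v\<close> act as probes. Units are good ones because a neighbourhood
  of a unit may have any nonzero modulus.\<close>

definition closure_le :: "'a topology \<Rightarrow> 'a \<Rightarrow> 'a \<Rightarrow> bool" where
  "closure_le T y x \<longleftrightarrow> (\<forall>v. supercentral T v \<longrightarrow> v \<noteq> x \<longrightarrow> v \<noteq> y \<longrightarrow>
     (\<forall>W. closure_filter T x v W \<longrightarrow> closure_filter T y v W))"

lemma closure_filter_mono:
  assumes "closure_filter T x y W" "W \<inter> topspace T \<subseteq> W'"
  shows "closure_filter T x y W'"
proof -
  obtain U V where "openin T U" "openin T V" "x \<in> U" "y \<in> V"
    "T closure_of U \<inter> T closure_of V \<subseteq> W"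
    using assms(1) unfolding closure_filter_def by blast
  moreover have "T closure_of U \<inter> T closure_of V \<subseteq> W'"
    using calculation(5) assms(2) closure_of_subset_topspace[of T U] by blast
  ultimately show ?thesis unfolding closure_filter_def by blast
qed

section \<open>Invariance under homeomorphisms\<close>

lemma closure_filter_image:
  assumes hk: "homeomorphic_maps T T h k" and "closure_filter T x y W"
  shows "closure_filter T (h x) (h y) (k -` W)"
proof -
  have hm: "homeomorphic_map T T h" using hk homeomorphic_map_maps by blast
  obtain U V where UV: "openin T U" "openin T V" "x \<in> U" "y \<in> V"
    "T closure_of U \<inter> T closure_of V \<subseteq> W"
    using assms(2) unfolding closure_filter_def by blast
  have op: "openin T (h ` U)" "openin T (h ` V)"
    using UV(1,2) homeomorphic_imp_open_map[OF hm] by (auto simp: open_map_def)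
  have cl: "T closure_of (h ` U) = h ` (T closure_of U)" "T closure_of (h ` V) = h ` (T closure_of V)"
    using homeomorphic_map_closure_of[OF hm] UV(1,2) openin_subset by blast+
  have inv: "k (h w) = w" if "w \<in> topspace T" for w
    using hk that unfolding homeomorphic_maps_def by blast
  have "h ` (T closure_of U) \<inter> h ` (T closure_of V) \<subseteq> k -` W"
  proof
    fix z assume "z \<in> h ` (T closure_of U) \<inter> h ` (T closure_of V)"
    then obtain u v where uv: "z = h u" "z = h v" "u \<in> T closure_of U" "v \<in> T closure_of V" by blast
    then have "u \<in> topspace T" "v \<in> topspace T"
      using closure_of_subset_topspace[of T] by blast+
    then have "k z = u" "k z = v" using inv[of u] inv[of v] uv(1,2) by simp_all
    then show "z \<in> k -` W" using uv UV(5) by auto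
  qed
  then show ?thesis
    unfolding closure_filter_def using op UV(3,4) cl by (metis imageI)
qed

lemma supercentral_image:
  assumes hk: "homeomorphic_maps T T h k" and "supercentral T x"
  shows "supercentral T (h x)"
proof -
  have kh: "homeomorphic_maps T T k h" using hk homeomorphic_maps_sym by blast
  have hT: "h z \<in> topspace T" "k (h z) = z" "h (k z) = z" if "z \<in> topspace T" for z
    using hk that unfolding homeomorphic_maps_def continuous_map_def by auto
  obtain y where y: "y \<in> topspace T" "y \<noteq> x"
    "\<And>W a b. closure_filter T a b W \<Longrightarrow> closure_filter T x y W" and x: "x \<in> topspace T"
    using assms(2) unfolding supercentral_def by blast
  have "closure_filter T (h x) (h y) W" if "closure_filter T a b W" for W a b
  proof -
    have "closure_filter T (h x) (h y) (k -` (h -` W))"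
      by (rule closure_filter_image[OF hk y(3)[OF closure_filter_image[OF kh that]]])
    then show ?thesis by (rule closure_filter_mono) (use hT in auto)
  qed
  moreover have "h y \<noteq> h x" using hT x y by metis
  ultimately show ?thesis unfolding supercentral_def using hT x y by blast
qed

lemma closure_le_image:
  assumes hk: "homeomorphic_maps T T h k" and "closure_le T y x" "x \<in> topspace T" "y \<in> topspace T"
  shows "closure_le T (h y) (h x)"
  unfolding closure_le_def
proof (intro allI impI)
  fix v W assume v: "supercentral T v" "v \<noteq> h x" "v \<noteq> h y" and W: "closure_filter T (h x) v W"
  have kh: "homeomorphic_maps T T k h" using hk homeomorphic_maps_sym by blast
  have hT: "k (h z) = z" "h (k z) = z" if "z \<in> topspace T" for z
    using hk that unfolding homeomorphic_maps_def by auto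
  have vT: "v \<in> topspace T" using v unfolding supercentral_def by blast
  have "closure_filter T x (k v) (h -` W)"
    using closure_filter_image[OF kh W] hT(1)[OF assms(3)] by simp
  moreover have "supercentral T (k v)" by (rule supercentral_image[OF kh v(1)])
  moreover have "k v \<noteq> x" "k v \<noteq> y" using v hT(2)[OF vT] by auto
  ultimately have "closure_filter T y (k v) (h -` W)"
    using assms(2) unfolding closure_le_def by blast
  then have "closure_filter T (h y) v (k -` (h -` W))"
    using closure_filter_image[OF hk] hT(2)[OF vT] by metis
  then show "closure_filter T (h y) v W" by (rule closure_filter_mono) (use hT in auto)
qed

text \<open>The modulus at \<open>x\<close> is prime to \<open>p\<close>, so only the one at
  \<open>y\<close> can impose a condition at \<open>p\<close>, and then \<open>p\<close> does not
  divide \<open>y\<close>. The witness satisfies this condition and is divisible by the parts of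
  both moduli prime to \<open>p\<close>.\<close>

lemma closure_filter_golomb_avoids_prime:
  fixes p :: "'a::field poly"
  assumes "irreducible p" "p dvd x" "closure_filter golomb_space x y W"
  shows "\<exists>w\<in>W. \<not> p dvd w"
proof -
  obtain U V where UV: "openin golomb_space U" "openin golomb_space V" "x \<in> U" "y \<in> V"
    "golomb_space closure_of U \<inter> golomb_space closure_of V \<subseteq> W"
    using assms(3) unfolding closure_filter_def by blast
  obtain i where i: "i \<noteq> 0" "comaximal x i" "coset x i \<subseteq> U"
    using UV(1,3) unfolding openin_golomb_space_iff by blast
  obtain j where j: "j \<noteq> 0" "comaximal y j" "coset y j \<subseteq> V"
    using UV(2,4) unfolding openin_golomb_space_iff by blast
  obtain e j' where e: "j = p ^ e * j'" "\<not> p dvd j'"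
    using irreducible_power_decompose[OF assms(1) j(1)] by blast
  have pi: "\<not> p dvd i"
    using comaximal_common_dvd_unit[OF i(2) assms(2)] irreducible_not_unit[OF assms(1)] by blast
  have co: "comaximal (p ^ e) (i * j')"
    using pi e(2) assms(1)
    by (intro comaximal_power_left) (simp add: irreducible_comaximal_iff irreducible_dvd_mult_poly)
  obtain w where w: "p ^ e dvd w - y" "i * j' dvd w - 0" "\<not> p dvd w"
  proof (cases e)
    case 0
    then show ?thesis using that[of "i * j'"] pi e(2) assms(1)
      by (simp add: irreducible_dvd_mult_poly)
  next
    case (Suc n)
    obtain w where w: "p ^ e dvd w - y" "i * j' dvd w - 0"
      using chinese_remainder_comaximal[OF co, of y 0] by blast
    have "p dvd j" using e Suc by simp
    then have "\<not> p dvd y"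
      using comaximal_common_dvd_unit[OF j(2)] irreducible_not_unit[OF assms(1)] by blast
    moreover have "p dvd w - y" using w(1) Suc by (auto dest: dvd_mult_left)
    ultimately have "\<not> p dvd w"
      by (metis diff_diff_eq2 add_diff_cancel_left' dvd_diff)
    then show ?thesis using that w by blast
  qed
  have w0: "w \<noteq> 0" using w(3) by auto
  have "w \<in> golomb_space closure_of coset x (1 * i)"
    by (rule in_closure_of_coset_if) (use w0 i w(2) in \<open>auto dest: dvd_mult_left dvd_trans\<close>)
  then have "w \<in> golomb_space closure_of U"
    using closure_of_mono[OF i(3), of golomb_space] by auto
  moreover have "w \<in> golomb_space closure_of coset y (p ^ e * j')"
  proof (rule in_closure_of_coset_if)
    show "comaximal (p ^ e) j'"
      by (rule comaximal_dvd_right[OF co]) simp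
    show "q dvd w" if "irreducible q" "q dvd j'" for q
      using that w(2) by (metis diff_zero dvd_mult dvd_trans)
  qed (use w0 e w(1) j(1) in auto)
  then have "w \<in> golomb_space closure_of V"
    using closure_of_mono[OF j(3), of golomb_space] e by auto
  ultimately show ?thesis using UV(5) w(3) by blast
qed

text \<open>Both closures contain every nonzero point divisible by all primes of the two
  moduli.\<close>

lemma closure_filter_golomb_large:
  fixes W :: "'a::field poly set"
  assumes "closure_filter golomb_space a b W"
  shows "\<exists>r. r \<noteq> 0 \<and>
    (\<forall>w. w \<noteq> 0 \<longrightarrow> (\<forall>p. irreducible p \<longrightarrow> p dvd r \<longrightarrow> p dvd w) \<longrightarrow> w \<in> W)"
proof -
  obtain U V where UV: "openin golomb_space U" "openin golomb_space V" "a \<in> U" "b \<in> V"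
    "golomb_space closure_of U \<inter> golomb_space closure_of V \<subseteq> W"
    using assms unfolding closure_filter_def by blast
  obtain i where i: "i \<noteq> 0" "comaximal a i" "coset a i \<subseteq> U"
    using UV(1,3) unfolding openin_golomb_space_iff by blast
  obtain j where j: "j \<noteq> 0" "comaximal b j" "coset b j \<subseteq> V"
    using UV(2,4) unfolding openin_golomb_space_iff by blast
  show ?thesis
  proof (intro exI[of _ "i * j"] conjI allI impI)
    fix w :: "'a poly"
    assume w: "w \<noteq> 0" "\<forall>p. irreducible p \<longrightarrow> p dvd i * j \<longrightarrow> p dvd w"
    have "w \<in> golomb_space closure_of coset a (1 * i)"
      by (rule in_closure_of_coset_if) (use w i in auto)
    moreover have "w \<in> golomb_space closure_of coset b (1 * j)"
      by (rule in_closure_of_coset_if) (use w j in auto)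
    ultimately show "w \<in> W"
      using closure_of_mono[OF i(3), of golomb_space] closure_of_mono[OF j(3), of golomb_space] UV(5)
      by auto
  qed (use i j in auto)
qed

text \<open>If \<open>p\<close> did not divide \<open>w\<close>, the full power of \<open>p\<close>
  in \<open>r * (y - v)\<close> would divide both \<open>w - y\<close> and \<open>w - v\<close>,
  hence \<open>y - v\<close>; but \<open>p dvd r\<close> makes the power in the product strictly
  larger.\<close>

lemma dvd_if_in_closures_of_cosets:
  fixes v y r :: "'a::field poly"
  assumes "y \<noteq> v" "r \<noteq> 0" "irreducible p" "p dvd r"
    and "w \<in> golomb_space closure_of coset y (r * (y - v))"
    and "w \<in> golomb_space closure_of coset v (r * (y - v))"
  shows "p dvd w"
proof (rule ccontr)
  assume pw: "\<not> p dvd w"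
  have "r * (y - v) \<noteq> 0" using assms by simp
  then obtain e m where e: "r * (y - v) = p ^ e * m" "\<not> p dvd m"
    using irreducible_power_decompose[OF assms(3)] by metis
  have co: "comaximal w (p ^ e)"
    by (subst comaximal_commute, rule comaximal_power_left)
       (simp add: irreducible_comaximal_iff assms pw)
  have "p ^ e \<noteq> 0" using assms(3) by auto
  then have "p ^ e dvd w - y" "p ^ e dvd w - v"
    using dvd_diff_if_in_closure_of_coset[OF assms(5) _ _ co]
      dvd_diff_if_in_closure_of_coset[OF assms(6) _ _ co] e(1) by auto
  then have "p ^ e dvd (w - v) - (w - y)" using dvd_diff by blast
  then have "p * p ^ e dvd r * (y - v)"
    using assms(4) by (intro mult_dvd_mono) auto
  then have "p ^ e * p dvd p ^ e * m" using e(1) by (simp add: mult.commute)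
  then show False using e(2) \<open>p ^ e \<noteq> 0\<close> by simp
qed

text \<open>As \<open>v\<close> is a unit, the modulus \<open>r * (y - v)\<close> is admissible at
  both points, and \<open>dvd_if_in_closures_of_cosets\<close> applies.\<close>

lemma closure_filter_golomb_radical:
  fixes v y r :: "'a::field poly"
  assumes "v dvd 1" "y \<noteq> v" "y \<noteq> 0" "r \<noteq> 0" "comaximal y r"
  shows "closure_filter golomb_space y v {w. \<forall>p. irreducible p \<longrightarrow> p dvd r \<longrightarrow> p dvd w}"
  unfolding closure_filter_def
proof (intro exI conjI)
  let ?m = "r * (y - v)"
  show "openin golomb_space (coset y ?m)"
    using assms by (intro openin_coset) (auto intro: comaximal_mult_right comaximal_diff_unit)
  show "openin golomb_space (coset v ?m)"
    using assms by (intro openin_coset) (auto intro: comaximal_unit_left)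
  show "y \<in> coset y ?m" "v \<in> coset v ?m" using assms by (auto simp: coset_def)
  show "golomb_space closure_of coset y ?m \<inter> golomb_space closure_of coset v ?m
      \<subseteq> {w. \<forall>p. irreducible p \<longrightarrow> p dvd r \<longrightarrow> p dvd w}"
    using dvd_if_in_closures_of_cosets[OF assms(2,4)] by blast
qed

lemma exists_const_poly_avoiding:
  fixes A :: "'a::field poly set"
  assumes "infinite (UNIV :: 'a set)" "finite A"
  obtains c :: 'a where "c \<noteq> 0" "[:c:] \<notin> A"
proof -
  have "finite (insert 0 ((\<lambda>c::'a. [:c:]) -` A))"
    using assms(2) by (intro finite.insertI finite_vimageI) (auto simp: inj_def)
  then obtain c :: 'a where "c \<notin> insert 0 ((\<lambda>c. [:c:]) -` A)"
    using ex_new_if_finite[OF assms(1)] by blast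
  then show ?thesis using that by auto
qed

text \<open>The filter of two distinct units contains, for each nonzero \<open>r\<close>, the set of
  all points divisible by the primes of \<open>r\<close>; every member of any filter contains such a
  set up to 0. If a prime \<open>p\<close> divides \<open>x\<close>, the multiples of
  \<open>p\<close> belong to no filter of \<open>x\<close>, though they belong to that of two
  units.\<close>

lemma supercentral_golomb_iff:
  fixes x :: "'a::field poly"
  assumes inf: "infinite (UNIV :: 'a set)"
  shows "supercentral golomb_space x \<longleftrightarrow> x dvd 1"
proof
  assume "x dvd 1"
  then have x0: "x \<noteq> 0" by auto
  obtain c where c: "c \<noteq> 0" "[:c:] \<notin> {1::'a poly}"
    using exists_const_poly_avoiding[OF inf, of "{1}"] by auto
  define y where "y = [:c:] * x"
  have "y - x = ([:c:] - 1) * x" by (simp add: y_def algebra_simps)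
  moreover have "[:c:] - 1 \<noteq> 0" using c(2) by simp
  ultimately have "y - x \<noteq> 0" using x0 by (metis mult_eq_0_iff)
  moreover have "[:c:] dvd 1" using c(1) by (rule is_unit_triv)
  then have "y dvd 1" using mult_dvd_mono[of "[:c:]" 1 x 1] \<open>x dvd 1\<close> by (simp add: y_def)
  ultimately have y: "y \<noteq> x" "y \<noteq> 0" "y dvd 1" by auto
  have "closure_filter golomb_space x y W" if W: "closure_filter golomb_space a b W" for W a b
  proof -
    obtain r where r: "r \<noteq> 0"
      "\<forall>w. w \<noteq> 0 \<longrightarrow> (\<forall>p. irreducible p \<longrightarrow> p dvd r \<longrightarrow> p dvd w) \<longrightarrow> w \<in> W"
      using closure_filter_golomb_large[OF W] by blast
    have "closure_filter golomb_space x y {w. \<forall>p. irreducible p \<longrightarrow> p dvd r \<longrightarrow> p dvd w}"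
      using y x0 r(1) \<open>x dvd 1\<close> by (intro closure_filter_golomb_radical comaximal_unit_left) auto
    then show ?thesis
      by (rule closure_filter_mono) (use r(2) in \<open>auto simp: topspace_golomb_space\<close>)
  qed
  then show "supercentral golomb_space x"
    unfolding supercentral_def using x0 y by (auto simp: topspace_golomb_space)
next
  assume x: "supercentral golomb_space x"
  then obtain y where y: "\<And>W a b. closure_filter golomb_space a b W \<Longrightarrow> closure_filter golomb_space x y W"
    unfolding supercentral_def by blast
  have x0: "x \<noteq> 0" using x unfolding supercentral_def by (auto simp: topspace_golomb_space)
  obtain c where c: "c \<noteq> 0" "[:c:] \<notin> {1::'a poly}"
    using exists_const_poly_avoiding[OF inf, of "{1}"] by auto
  show "x dvd 1"
  proof (rule ccontr)
    assume "\<not> x dvd 1"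
    then obtain p where p: "irreducible p" "p dvd x" using irreducible_dvd_exists x0 by blast
    have "closure_filter golomb_space [:c:] 1 {w. \<forall>q. irreducible q \<longrightarrow> q dvd p \<longrightarrow> q dvd w}"
      using c p by (intro closure_filter_golomb_radical comaximal_unit_left)
        (auto simp: is_unit_triv)
    from closure_filter_golomb_avoids_prime[OF p y[OF this]] p(1) show False by auto
  qed
qed

text \<open>If \<open>p\<close> divides \<open>y\<close> but not \<open>x\<close>, the multiples of
  \<open>p\<close> belong to the filter of \<open>x\<close> and a constant but not to that of
  \<open>y\<close> and the constant. Conversely, a modulus \<open>i\<close> at \<open>x\<close> is
  admissible at \<open>y\<close>; multiplied by \<open>y - v\<close>, it makes all points of both
  closures divisible by the primes of \<open>i\<close>, which puts them into the closure of
  \<open>coset x i\<close>.\<close>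

lemma closure_le_golomb_iff:
  fixes x y :: "'a::field poly"
  assumes inf: "infinite (UNIV :: 'a set)" and nz: "x \<noteq> 0" "y \<noteq> 0"
  shows "closure_le golomb_space y x \<longleftrightarrow> (\<forall>p. irreducible p \<longrightarrow> p dvd y \<longrightarrow> p dvd x)"
proof
  assume le: "closure_le golomb_space y x"
  obtain c where c: "c \<noteq> 0" "[:c:] \<notin> {x, y}"
    using exists_const_poly_avoiding[OF inf, of "{x, y}"] by auto
  show "\<forall>p. irreducible p \<longrightarrow> p dvd y \<longrightarrow> p dvd x"
  proof (intro allI impI, rule ccontr)
    fix p assume p: "irreducible p" "p dvd y" "\<not> p dvd x"
    have "closure_filter golomb_space x [:c:] {w. \<forall>q. irreducible q \<longrightarrow> q dvd p \<longrightarrow> q dvd w}"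
      using c p nz by (intro closure_filter_golomb_radical)
        (auto simp: is_unit_triv comaximal_commute[of x] irreducible_comaximal_iff)
    then have "closure_filter golomb_space y [:c:] {w. \<forall>q. irreducible q \<longrightarrow> q dvd p \<longrightarrow> q dvd w}"
      using le c unfolding closure_le_def
      by (auto simp: supercentral_golomb_iff[OF inf] is_unit_triv)
    from closure_filter_golomb_avoids_prime[OF p(1,2) this] p(1) show False by auto
  qed
next
  assume sub: "\<forall>p. irreducible p \<longrightarrow> p dvd y \<longrightarrow> p dvd x"
  show "closure_le golomb_space y x"
    unfolding closure_le_def supercentral_golomb_iff[OF inf]
  proof (intro allI impI)
    fix v W assume v: "v dvd 1" "v \<noteq> x" "v \<noteq> y" and W: "closure_filter golomb_space x v W"
    obtain U V where UV: "openin golomb_space U" "openin golomb_space V" "x \<in> U" "v \<in> V"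
      "golomb_space closure_of U \<inter> golomb_space closure_of V \<subseteq> W"
      using W unfolding closure_filter_def by blast
    obtain i where i: "i \<noteq> 0" "comaximal x i" "coset x i \<subseteq> U"
      using UV(1,3) unfolding openin_golomb_space_iff by blast
    obtain j where j: "j \<noteq> 0" "comaximal v j" "coset v j \<subseteq> V"
      using UV(2,4) unfolding openin_golomb_space_iff by blast
    have yi: "comaximal y i"
    proof (rule comaximal_polyI)
      fix p assume p: "irreducible p" "p dvd y" "p dvd i"
      then show False
        using comaximal_common_dvd_unit[OF i(2) _ p(3)] irreducible_not_unit[OF p(1)] sub by blast
    qed (use nz in auto)
    let ?m = "i * (y - v)"
    show "closure_filter golomb_space y v W"
      unfolding closure_filter_def
    proof (intro exI conjI)
      show "openin golomb_space (coset y ?m)"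
        using v i nz yi by (intro openin_coset) (auto intro: comaximal_mult_right comaximal_diff_unit)
      show "openin golomb_space (coset v (?m * j))"
        using v i j by (intro openin_coset) (auto intro: comaximal_unit_left)
      show "y \<in> coset y ?m" "v \<in> coset v (?m * j)" using v nz by (auto simp: coset_def)
      show "golomb_space closure_of coset y ?m \<inter> golomb_space closure_of coset v (?m * j) \<subseteq> W"
      proof
        fix w assume w: "w \<in> golomb_space closure_of coset y ?m \<inter>
          golomb_space closure_of coset v (?m * j)"
        have "coset v (?m * j) \<subseteq> coset v ?m" "coset v (?m * j) \<subseteq> coset v j"
          by (auto simp: coset_def dest: dvd_mult_left dvd_mult_right)
        then have w': "w \<in> golomb_space closure_of coset v ?m" "w \<in> golomb_space closure_of V"
          using w closure_of_mono[of _ _ golomb_space] j(3) by blast+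
        have w0: "w \<noteq> 0" using w by (auto simp: in_closure_of topspace_golomb_space)
        have "w \<in> golomb_space closure_of coset x (1 * i)"
        proof (rule in_closure_of_coset_if)
          fix p assume "irreducible p" "p dvd i"
          then show "p dvd w"
            using dvd_if_in_closures_of_cosets[of y v i p w] v i w w'(1) by blast
        qed (use w0 i in auto)
        then show "w \<in> W"
          using closure_of_mono[OF i(3), of golomb_space] w'(2) UV(5) by auto
      qed
    qed
  qed
qed

subsection \<open>Powers close to one\<close>

lemma power_CHAR_power_minus_one:
  fixes t :: "'a::field poly"
  assumes "CHAR('a) > 0"
  shows "t ^ (CHAR('a) ^ j) - 1 = (t - 1) ^ (CHAR('a) ^ j)"
proof -
  have "prime CHAR('a poly)" using prime_CHAR_semidom[OF assms] by simp
  then have "((t - 1) + 1) ^ (CHAR('a) ^ j) = (t - 1) ^ (CHAR('a) ^ j) + 1 ^ (CHAR('a) ^ j)"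
    by (rule freshmans_dream') simp
  then show ?thesis by simp
qed

text \<open>Modulo \<open>q\<close> each \<open>t ^ i\<close> is 1, so the sum reduces to
  \<open>l\<close>, a nonzero constant of the field.\<close>

lemma irreducible_not_dvd_geometric_sum:
  fixes q t :: "'a::field poly"
  assumes "irreducible q" "q dvd t - 1" "\<not> CHAR('a) dvd l"
  shows "\<not> q dvd (\<Sum>i<l. t ^ i)"
proof
  assume "q dvd (\<Sum>i<l. t ^ i)"
  moreover have "q dvd (\<Sum>i<l. t ^ i - 1)"
  proof (rule dvd_sum)
    fix i
    have "t - 1 dvd t ^ i - 1" by (simp add: power_diff_1_eq)
    then show "q dvd t ^ i - 1" using assms(2) dvd_trans by blast
  qed
  ultimately have "q dvd (\<Sum>i<l. t ^ i) - (\<Sum>i<l. t ^ i - 1)" by (rule dvd_diff)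
  then have "q dvd of_nat l" by (simp add: sum_subtractf)
  moreover have "(of_nat l :: 'a) \<noteq> 0" using assms(3) by (simp add: of_nat_eq_0_iff_char_dvd)
  then have "(of_nat l :: 'a poly) dvd 1" by (simp add: of_nat_poly is_unit_triv)
  ultimately show False using irreducible_not_unit[OF assms(1)] dvd_trans by blast
qed

text \<open>With \<open>p\<close> the characteristic, closeness of \<open>t ^ n\<close> to 1 at \<open>q'\<close> and at \<open>q\<close> are both equivalent
  to \<open>n\<close> being divisible by a large power of \<open>p\<close>.\<close>

lemma power_near_one_transfer:
  fixes t q q' :: "'a::field poly"
  assumes char: "CHAR('a) > 0" and t: "t \<noteq> 1"
    and q: "q dvd t - 1" and q': "irreducible q'" "q' dvd t - 1"
  shows "\<exists>m. \<forall>n. q' ^ m dvd t ^ n - 1 \<longrightarrow> q ^ M dvd t ^ n - 1"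
proof (intro exI allI impI)
  let ?p = "CHAR('a)"
  \<comment> \<open>Comparing degrees will give \<open>?m \<le> ?p ^ j * degree (t - 1)\<close>; the
    summand 1 makes the inequality for \<open>M\<close> strict, so that the degree cancels.\<close>
  let ?m = "M * degree (t - 1) + 1"
  fix n assume n: "q' ^ ?m dvd t ^ n - 1"
  show "q ^ M dvd t ^ n - 1"
  proof (cases "n = 0")
    case False
    have "prime ?p" by (rule prime_CHAR_semidom[OF char])
    then have "\<not> is_unit ?p" by (simp add: not_prime_unit)
    from multiplicity_decompose'[OF False this]
    obtain j l where jl: "n = ?p ^ j * l" "\<not> ?p dvd l" by metis
    have "t ^ n - 1 = (t ^ l) ^ (?p ^ j) - 1"
      by (simp add: jl(1) power_mult[symmetric] mult.commute)
    also have "\<dots> = (t ^ l - 1) ^ (?p ^ j)" by (rule power_CHAR_power_minus_one[OF char])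
    also have "\<dots> = (t - 1) ^ (?p ^ j) * (\<Sum>i<l. t ^ i) ^ (?p ^ j)"
      by (simp add: power_diff_1_eq power_mult_distrib)
    finally have eq: "t ^ n - 1 = (\<Sum>i<l. t ^ i) ^ (?p ^ j) * (t - 1) ^ (?p ^ j)"
      by (simp add: mult.commute)
    have "\<not> q' dvd (\<Sum>i<l. t ^ i) ^ (?p ^ j)"
      using irreducible_dvd_power_poly[OF q'(1)] irreducible_not_dvd_geometric_sum[OF q' jl(2)]
      by blast
    then have "comaximal (q' ^ ?m) ((\<Sum>i<l. t ^ i) ^ (?p ^ j))"
      by (intro comaximal_power_left) (simp add: irreducible_comaximal_iff[OF q'(1)])
    then have "q' ^ ?m dvd (t - 1) ^ (?p ^ j)"
      by (rule comaximal_dvd_mult) (use n eq in simp)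
    then have "degree (q' ^ ?m) \<le> degree ((t - 1) ^ (?p ^ j))"
      using t by (intro dvd_imp_degree_le) auto
    moreover have "q' \<noteq> 0" using q'(1) by auto
    ultimately have "?m * degree q' \<le> ?p ^ j * degree (t - 1)"
      using t by (simp only: degree_power_eq right_minus_eq not_False_eq_True)
    moreover have "degree q' > 0"
      using q'(1) by (metis bot_nat_0.not_eq_extremum irreducible_def is_unit_iff_degree)
    ultimately have "?m \<le> ?p ^ j * degree (t - 1)"
      by (metis One_nat_def Suc_leI mult.right_neutral mult_le_mono2 order_trans)
    then have "M * degree (t - 1) < ?p ^ j * degree (t - 1)" by linarith
    then have "M \<le> ?p ^ j" by simp
    then have "q ^ M dvd q ^ (?p ^ j)" by (rule le_imp_power_dvd)
    also have "\<dots> dvd (t - 1) ^ (?p ^ j)" using q by (rule dvd_power_same)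
    finally show ?thesis unfolding eq by (rule dvd_mult)
  qed auto
qed

subsection \<open>Bijections conjugating polynomials to polynomials\<close>

lemma poly_eqI_surj:
  fixes p q :: "'a::field poly"
  assumes "infinite (UNIV :: 'a set)" "surj \<phi>" "\<And>a. poly p (\<phi> a) = poly q (\<phi> a)"
  shows "p = q"
proof (rule ccontr)
  assume "p \<noteq> q"
  then have "finite {x. poly (p - q) x = 0}" by (intro poly_roots_finite) simp
  moreover have "{x. poly (p - q) x = 0} = UNIV"
    using assms(2,3) by (auto simp: surj_def) metis
  ultimately show False using assms(1) by simp
qed

lemma degree_eq_1_if_pcompose_eq_X:
  assumes "p \<circ>\<^sub>p q = [:0, 1::'a::field:]"
  shows "degree p = 1" "degree q = 1"
proof -
  have "degree p * degree q = 1"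
    using assms by (metis degree_pCons_eq_if degree_pcompose degree_0 one_neq_zero pCons_eq_0_iff One_nat_def)
  then show "degree p = 1" "degree q = 1" by auto
qed

lemma poly_degree_1:
  assumes "degree p = 1"
  obtains a b where "a \<noteq> (0::'a::field)" "\<And>x. poly p x = a * x + b"
proof -
  obtain b a where "p = [:b, a:]" "a \<noteq> 0"
    using degree1_coeffs[OF assms] by metis
  then show ?thesis using that[of a b] by (simp add: algebra_simps)
qed

lemma poly_bij_conjugate:
  fixes H :: "'a::field poly \<Rightarrow> 'a poly" and \<phi> \<sigma> :: "'a \<Rightarrow> 'a"
  assumes inf: "infinite (UNIV :: 'a set)" and surj: "surj \<phi>" and bijH: "bij H" and bijs: "bij \<sigma>"
    and s0: "\<sigma> 0 = 0" and H: "\<And>z a. poly (H z) (\<phi> a) = \<sigma> (poly z a)"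
  shows "\<sigma> (x + a) = \<sigma> x + \<sigma> a" "\<sigma> (x * a) * \<sigma> 1 = \<sigma> x * \<sigma> a"
proof -
  \<comment> \<open>Both polynomials come from the identity function:
    \<open>\<sigma> = \<psi> \<circ> \<phi>\<close> and
    \<open>\<phi> = \<sigma> \<circ> \<zeta>\<close> as functions.\<close>
  define \<psi> where "\<psi> = H [:0, 1:]"
  obtain \<zeta> where \<zeta>: "H \<zeta> = [:0, 1:]" using bijH by (metis bij_pointE)
  have \<sigma>_\<psi>: "\<sigma> a = poly \<psi> (\<phi> a)" for a by (simp add: \<psi>_def H)
  have \<phi>_\<zeta>: "\<phi> a = \<sigma> (poly \<zeta> a)" for a using H[of \<zeta> a] by (simp add: \<zeta>)
  \<comment> \<open>\<open>C w\<close> represents the conjugate of \<open>w\<close> by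
    \<open>\<phi>\<close>, since \<open>\<zeta>\<close> turns the outer \<open>\<sigma>\<close> into
    \<open>\<phi>\<close>.\<close>
  define C where "C w = H (\<zeta> \<circ>\<^sub>p w)" for w
  have C: "poly (C w) (\<phi> a) = \<phi> (poly w a)" for w a
    by (simp add: C_def H poly_pcompose \<phi>_\<zeta>[symmetric])
  \<comment> \<open>So \<open>\<psi>\<close> is affine, and affine conjugates by
    \<open>\<phi>\<close> yield affine conjugates by \<open>\<sigma>\<close>.\<close>
  have "\<psi> \<circ>\<^sub>p C \<zeta> = [:0, 1:]"
    by (rule poly_eqI_surj[OF inf surj]) (simp add: poly_pcompose C \<sigma>_\<psi>[symmetric] \<phi>_\<zeta>[symmetric])
  then have "degree \<psi> = 1" by (rule degree_eq_1_if_pcompose_eq_X)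
  then obtain \<alpha> \<beta> where \<alpha>: "\<alpha> \<noteq> 0" "\<And>x. poly \<psi> x = \<alpha> * x + \<beta>"
    using poly_degree_1 by blast
  have aff: "\<exists>l m. l \<noteq> 0 \<and> (\<forall>x. \<sigma> (poly w x) = l * \<sigma> x + m)" if w: "w \<circ>\<^sub>p w' = [:0, 1:]" for w w'
  proof -
    have "poly w (poly w' x) = x" for x using arg_cong[OF w, of "\<lambda>p. poly p x"] by (simp add: poly_pcompose)
    then have "C w \<circ>\<^sub>p C w' = [:0, 1:]"
      by (intro poly_eqI_surj[OF inf surj]) (simp add: poly_pcompose C)
    then have "degree (C w) = 1" by (rule degree_eq_1_if_pcompose_eq_X)
    then obtain l m where l: "l \<noteq> 0" "\<And>x. poly (C w) x = l * x + m"
      using poly_degree_1 by blast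
    have "\<sigma> (poly w x) = l * \<sigma> x + (\<alpha> * m + \<beta> - l * \<beta>)" for x
      by (simp add: \<sigma>_\<psi> \<alpha>(2) C[symmetric] l(2) algebra_simps)
    then show ?thesis using l(1) by blast
  qed
  have inj: "\<sigma> x = \<sigma> y \<Longrightarrow> x = y" for x y using bijs by (auto simp: bij_def inj_def)
  show "\<sigma> (x + a) = \<sigma> x + \<sigma> a"
  proof (cases "a = 0")
    case False
    obtain l m where l: "\<And>x. \<sigma> (poly [:a, 1:] x) = l * \<sigma> x + m"
      using aff[of "[:a, 1:]" "[:- a, 1:]"] by (auto simp: pcompose_pCons)
    have m: "m = \<sigma> a" using l[of 0] s0 by simp
    \<comment> \<open>Otherwise \<open>\<lambda>x. l * x + m\<close> has a fixed point, whose
      preimage under \<open>\<sigma>\<close> would be fixed by the translation by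
      \<open>a\<close>.\<close>
    have "l = 1"
    proof (rule ccontr)
      assume l1: "l \<noteq> 1"
      obtain y where "\<sigma> y = m / (1 - l)" using bijs by (metis bij_pointE)
      then have "\<sigma> (poly [:a, 1:] y) = \<sigma> y"
        using l1 by (simp only: l) (simp add: field_simps)
      then show False using inj[of "poly [:a, 1:] y" y] False by simp
    qed
    then show ?thesis using l[of x] m by (simp add: add.commute)
  qed (simp add: s0)
  show "\<sigma> (x * a) * \<sigma> 1 = \<sigma> x * \<sigma> a"
  proof (cases "a = 0")
    case False
    obtain l m where l: "\<And>x. \<sigma> (poly [:0, a:] x) = l * \<sigma> x + m"
      using aff[of "[:0, a:]" "[:0, 1 / a:]"] False by (auto simp: pcompose_pCons)
    \<comment> \<open>The homothety fixes 0, so its conjugate is a homothety as well; its factor is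
      read off at 1.\<close>
    have "m = 0" using l[of 0] s0 by simp
    then have "\<sigma> (x * a) = l * \<sigma> x" "\<sigma> a = l * \<sigma> 1" using l[of x] l[of 1] by simp_all
    then show ?thesis by simp
  qed (simp add: s0)
qed

text \<open>Polynomials are compared through their values at the points \<open>\<phi> a\<close>, on
  which \<open>H\<close> acts as the additive map \<open>\<sigma>\<close>; division by
  \<open>\<sigma> 1\<close> makes it multiplicative and unital.\<close>

lemma ring_automorphism_if_poly_bij_conjugate:
  fixes H :: "'a::field poly \<Rightarrow> 'a poly" and \<phi> \<sigma> :: "'a \<Rightarrow> 'a"
  assumes inf: "infinite (UNIV :: 'a set)" and surj: "surj \<phi>" and bijH: "bij H" and bijs: "bij \<sigma>"
    and s0: "\<sigma> 0 = 0" and H: "\<And>z a. poly (H z) (\<phi> a) = \<sigma> (poly z a)"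
  shows "\<sigma> 1 \<noteq> 0" "ring_automorphism (\<lambda>z. smult (inverse (\<sigma> 1)) (H z))"
proof -
  note hom = poly_bij_conjugate[OF assms]
  show s1: "\<sigma> 1 \<noteq> 0" using bijs s0 by (metis bij_pointE zero_neq_one)
  let ?S = "\<lambda>z. smult (inverse (\<sigma> 1)) (H z)"
  have S: "poly (?S z) (\<phi> a) = \<sigma> (poly z a) / \<sigma> 1" for z a
    by (simp add: H divide_inverse mult.commute)
  have "bij ?S"
  proof (rule o_bij)
    show "(\<lambda>z. inv H (smult (\<sigma> 1) z)) \<circ> ?S = id"
      using bijH s1 by (auto simp: fun_eq_iff bij_def)
    show "?S \<circ> (\<lambda>z. inv H (smult (\<sigma> 1) z)) = id"
      using bijH s1 by (auto simp: fun_eq_iff bij_def surj_f_inv_f)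
  qed
  moreover have "?S 1 = 1"
    by (rule poly_eqI_surj[OF inf surj]) (use s1 in \<open>simp only: S, simp\<close>)
  moreover have "?S (x + y) = ?S x + ?S y" for x y
    by (rule poly_eqI_surj[OF inf surj])
       (simp only: S poly_add hom(1) add_divide_distrib)
  moreover have "?S (x * y) = ?S x * ?S y" for x y
  proof (rule poly_eqI_surj[OF inf surj])
    fix a
    have "\<sigma> (poly x a * poly y a) / \<sigma> 1 = (\<sigma> (poly x a) / \<sigma> 1) * (\<sigma> (poly y a) / \<sigma> 1)"
      using hom(2)[of "poly x a" "poly y a"] s1 by (simp add: field_simps)
    then show "poly (?S (x * y)) (\<phi> a) = poly (?S x * ?S y) (\<phi> a)"
      by (simp only: S poly_mult)
  qed
  ultimately show "ring_automorphism ?S"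
    unfolding ring_automorphism_def by blast
qed

subsection \<open>Congruences to constants\<close>

lemma unit_poly_const:
  fixes p :: "'a::field poly"
  assumes "p dvd 1"
  obtains c where "c \<noteq> 0" "p = [:c:]"
  using assms that unfolding is_unit_poly_iff by (metis dvd_0_left zero_neq_one)

text \<open>The inverse is a parameter, so that interpretation with \<open>h\<close> and
  \<open>k\<close> exchanged yields each result for the inverse too.\<close>

locale golomb_homeo =
  fixes h k :: "'a::field poly \<Rightarrow> 'a poly"
  assumes infinite_field: "infinite (UNIV :: 'a set)"
    and homeo: "homeomorphic_maps golomb_space golomb_space h k"
begin

lemma inverse_homeo: "golomb_homeo k h"
  using infinite_field homeo homeomorphic_maps_sym by unfold_locales blast+

lemma nonzero: "x \<noteq> 0 \<Longrightarrow> h x \<noteq> 0" "x \<noteq> 0 \<Longrightarrow> k x \<noteq> 0"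
  and inverse: "x \<noteq> 0 \<Longrightarrow> k (h x) = x" "x \<noteq> 0 \<Longrightarrow> h (k x) = x"
  using homeo unfolding homeomorphic_maps_def continuous_map_def
  by (auto simp: topspace_golomb_space)

lemma unit: "x dvd 1 \<Longrightarrow> h x dvd 1"
  using supercentral_image[OF homeo, of x] by (simp add: supercentral_golomb_iff[OF infinite_field])

lemma radical:
  assumes "x \<noteq> 0" "y \<noteq> 0" "\<forall>p. irreducible p \<longrightarrow> p dvd y \<longrightarrow> p dvd x"
  shows "\<forall>p. irreducible p \<longrightarrow> p dvd h y \<longrightarrow> p dvd h x"
  using closure_le_image[OF homeo, of y x] assms
  by (simp add: closure_le_golomb_iff[OF infinite_field] nonzero topspace_golomb_space)

section \<open>Corresponding primes and adic continuity\<close>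

definition prime_corr :: "'a poly \<Rightarrow> 'a poly \<Rightarrow> bool" where
  "prime_corr q g \<longleftrightarrow> irreducible q \<and> irreducible g \<and> (\<forall>x. x \<noteq> 0 \<longrightarrow> (q dvd x \<longleftrightarrow> g dvd h x))"

lemma prime_corr_inverse: "prime_corr q g \<Longrightarrow> golomb_homeo.prime_corr k g q"
  unfolding prime_corr_def golomb_homeo.prime_corr_def[OF inverse_homeo]
  using nonzero inverse by metis

text \<open>Let \<open>g\<close> be a prime of \<open>h q\<close>. By \<open>radical\<close> for
  \<open>k\<close>, the primes of \<open>k g\<close> all divide \<open>q\<close>; as
  \<open>k g\<close> is not a unit, it has the same primes as \<open>q\<close>. Then
  \<open>radical\<close> in both directions transfers divisibility.\<close>

lemma ex_prime_corr:
  assumes q: "irreducible q"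
  obtains g where "prime_corr q g"
proof -
  interpret inv: golomb_homeo k h by (rule inverse_homeo)
  have q0: "q \<noteq> 0" using q by auto
  have "\<not> h q dvd 1"
    using inv.unit[of "h q"] irreducible_not_unit[OF q] inverse(1)[OF q0] by auto
  then obtain g where g: "irreducible g" "g dvd h q"
    using irreducible_dvd_exists[OF nonzero(1)[OF q0]] by blast
  have g0: "g \<noteq> 0" using g by auto
  have kg: "\<forall>p. irreducible p \<longrightarrow> p dvd k g \<longrightarrow> p dvd q"
    using inv.radical[of "h q" g] g0 nonzero(1)[OF q0] g(2) inverse(1)[OF q0] dvd_trans by metis
  have "\<not> k g dvd 1"
    using unit[of "k g"] irreducible_not_unit[OF g(1)] inverse(2)[OF g0] by auto
  then obtain p where p: "irreducible p" "p dvd k g"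
    using irreducible_dvd_exists[OF nonzero(2)[OF g0]] by blast
  then have "p dvd q" using kg by blast
  then have "q dvd p" using irreducibleD'[OF q] irreducible_not_unit[OF p(1)] by blast
  then have qkg: "q dvd k g" using p(2) dvd_trans by blast
  have "q dvd x \<longleftrightarrow> g dvd h x" if x: "x \<noteq> 0" for x
  proof
    assume "q dvd x"
    then have "\<forall>p. irreducible p \<longrightarrow> p dvd q \<longrightarrow> p dvd x" using dvd_trans by blast
    then show "g dvd h x" using radical[OF x q0] g by blast
  next
    assume "g dvd h x"
    then have "\<forall>p. irreducible p \<longrightarrow> p dvd g \<longrightarrow> p dvd h x" using dvd_trans by blast
    then have "\<forall>p. irreducible p \<longrightarrow> p dvd k g \<longrightarrow> p dvd x"
      using inv.radical[OF nonzero(1)[OF x] g0] inverse(1)[OF x] by simp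
    then show "q dvd x" using q qkg by blast
  qed
  then show ?thesis using that q g(1) unfolding prime_corr_def by blast
qed

lemma openin_vimage:
  "openin golomb_space U \<Longrightarrow> openin golomb_space {w. w \<noteq> 0 \<and> h w \<in> U}"
  using homeo openin_continuous_map_preimage[of golomb_space golomb_space h U]
  by (simp add: homeomorphic_maps_def topspace_golomb_space)

text \<open>If \<open>y\<close> is \<open>q\<close>-adically close to \<open>x\<close>, then the closures of any neighbourhood of \<open>y\<close> and of
  the given neighbourhood of \<open>x\<close> meet outside \<open>q\<close>. So a set that is clopen outside \<open>q\<close>, such as
  the preimage of a \<open>g\<close>-adic ball, contains \<open>y\<close> together with \<open>x\<close>.\<close>

lemma adic_continuity:
  assumes c: "prime_corr q g" and x: "x \<noteq> 0" "\<not> q dvd x"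
  shows "\<exists>e. \<forall>y. q ^ e dvd y - x \<longrightarrow> g ^ n dvd h y - h x"
proof -
  have q: "irreducible q" and g: "irreducible g"
    and qg: "\<And>x. x \<noteq> 0 \<Longrightarrow> q dvd x \<longleftrightarrow> g dvd h x"
    using c unfolding prime_corr_def by blast+
  have q0: "q \<noteq> 0" and g0: "g \<noteq> 0" using q g by auto
  \<comment> \<open>A positive exponent ensures \<open>g dvd m\<close>, so congruence modulo
    \<open>m\<close> preserves non-divisibility by \<open>g\<close>.\<close>
  define m where "m = g ^ Suc n"
  have m0: "m \<noteq> 0" and gm: "g dvd m" using g0 by (auto simp: m_def)
  have com: "comaximal v m" if "\<not> g dvd v" for v
    unfolding m_def by (subst comaximal_commute, rule comaximal_power_left)
      (simp add: irreducible_comaximal_iff[OF g] that)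
  \<comment> \<open>\<open>A\<close> and \<open>B\<close> are disjoint open sets that together cover
    all points not divisible by \<open>q\<close>.\<close>
  define A where "A = {w. w \<noteq> 0 \<and> h w \<in> coset (h x) m}"
  define B where "B = {w. w \<noteq> 0 \<and> h w \<in> {v. v \<noteq> 0 \<and> \<not> g dvd v \<and> \<not> m dvd v - h x}}"
  have ghx: "\<not> g dvd h x" using qg x by blast
  have opA: "openin golomb_space A"
    unfolding A_def using nonzero(1)[OF x(1)] m0 com[OF ghx] by (intro openin_vimage openin_coset)
  have "openin golomb_space {v. v \<noteq> 0 \<and> \<not> g dvd v \<and> \<not> m dvd v - h x}"
    unfolding openin_golomb_space_iff
  proof (intro conjI ballI exI)
    fix v assume "v \<in> {v. v \<noteq> 0 \<and> \<not> g dvd v \<and> \<not> m dvd v - h x}"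
    then have v: "v \<noteq> 0" "\<not> g dvd v" "\<not> m dvd v - h x" by auto
    show "comaximal v m" using com v by blast
    show "coset v m \<subseteq> {v. v \<noteq> 0 \<and> \<not> g dvd v \<and> \<not> m dvd v - h x}"
    proof
      fix u assume "u \<in> coset v m"
      then have u: "u \<noteq> 0" "m dvd u - v" by (auto simp: coset_def)
      have "\<not> g dvd u"
      proof
        assume "g dvd u"
        moreover have "g dvd u - v" using gm u(2) dvd_trans by blast
        ultimately have "g dvd u - (u - v)" by (rule dvd_diff)
        then show False using v(2) by simp
      qed
      moreover have "\<not> m dvd u - h x"
      proof
        assume "m dvd u - h x"
        then have "m dvd (u - h x) - (u - v)" using u(2) by (rule dvd_diff)
        then show False using v(3) by simp
      qed
      ultimately show "u \<in> {v. v \<noteq> 0 \<and> \<not> g dvd v \<and> \<not> m dvd v - h x}" using u(1) by blast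
    qed
  qed (use m0 in auto)
  then have opB: "openin golomb_space B" unfolding B_def by (rule openin_vimage)
  have disj: "A \<inter> B = {}" by (auto simp: A_def B_def coset_def)
  have AB: "w \<in> A \<union> B" if "w \<noteq> 0" "\<not> q dvd w" for w
    using that qg nonzero(1) by (auto simp: A_def B_def coset_def)
  have "x \<in> A" using x nonzero(1) by (simp add: A_def coset_def)
  then obtain i where i: "i \<noteq> 0" "comaximal x i" "coset x i \<subseteq> A"
    using opA unfolding openin_golomb_space_iff by blast
  obtain e i' where e: "i = q ^ e * i'" "\<not> q dvd i'"
    using irreducible_power_decompose[OF q i(1)] by blast
  show ?thesis
  \<comment> \<open>The successor yields congruence modulo \<open>q\<close> even if \<open>e\<close>
    is 0, so that \<open>q\<close> does not divide \<open>y\<close>.\<close>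
  proof (intro exI[of _ "Suc e"] allI impI)
    fix y assume y: "q ^ Suc e dvd y - x"
    have qy: "\<not> q dvd y"
    proof
      assume "q dvd y"
      moreover have "q dvd y - x" using y by (auto dest: dvd_mult_left)
      ultimately have "q dvd y - (y - x)" by (rule dvd_diff)
      then show False using x(2) by simp
    qed
    then have y0: "y \<noteq> 0" by auto
    have "y \<in> A"
    proof (rule ccontr)
      assume "y \<notin> A"
      then have "y \<in> B" using AB y0 qy by blast
      then obtain j where j: "j \<noteq> 0" "comaximal y j" "coset y j \<subseteq> B"
        using opB unfolding openin_golomb_space_iff by blast
      obtain f j' where f: "j = q ^ f * j'" "\<not> q dvd j'"
        using irreducible_power_decompose[OF q j(1)] by blast
      have co: "comaximal (q ^ l) (i' * j')" for l
        using e(2) f(2) by (intro comaximal_power_left)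
          (simp add: irreducible_comaximal_iff[OF q] irreducible_dvd_mult_poly[OF q])
      \<comment> \<open>This point is close to \<open>y\<close>, hence to \<open>x\<close>, at
        \<open>q\<close> and divisible by the remaining parts of both moduli; so it lies in the
        closures of both cosets.\<close>
      obtain w where w: "q ^ Suc (e + f) dvd w - y" "i' * j' dvd w - 0"
        using chinese_remainder_comaximal[OF co, of _ y 0] by blast
      have qw: "\<not> q dvd w"
      proof
        assume "q dvd w"
        moreover have "q dvd w - y" using w(1) by (auto dest: dvd_mult_left)
        ultimately have "q dvd w - (w - y)" by (rule dvd_diff)
        then show False using qy by simp
      qed
      then have w0: "w \<noteq> 0" by auto
      have ij: "i' dvd w" "j' dvd w" using w(2) by (auto dest: dvd_mult_left dvd_mult_right)
      have "q ^ e dvd w - y" using w(1) by (rule power_le_dvd) simp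
      moreover have "q ^ e dvd y - x" using y by (rule power_le_dvd) simp
      ultimately have "q ^ e dvd (w - y) + (y - x)" by (rule dvd_add)
      then have wx: "q ^ e dvd w - x" by simp
      have wx': "w \<in> golomb_space closure_of coset x i"
        unfolding e(1)
      proof (rule in_closure_of_coset_if)
        show "comaximal (q ^ e) i'" by (rule comaximal_dvd_right[OF co]) simp
      qed (use w0 q0 i(1) e(1) wx ij(1) dvd_trans in auto)
      have wy: "w \<in> golomb_space closure_of coset y j"
        unfolding f(1)
      proof (rule in_closure_of_coset_if)
        show "comaximal (q ^ f) j'" by (rule comaximal_dvd_right[OF co]) simp
        show "q ^ f dvd w - y" using w(1) by (rule power_le_dvd) simp
      qed (use w0 q0 j(1) f(1) ij(2) dvd_trans in auto)
      \<comment> \<open>Whichever open set contains \<open>w\<close> would meet a coset inside the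
        other one.\<close>
      consider "w \<in> A" | "w \<in> B" using AB w0 qw by blast
      then show False
      proof cases
        case 1
        then show False using wy opA j(3) disj unfolding in_closure_of by blast
      next
        case 2
        then show False using wx' opB i(3) disj unfolding in_closure_of by blast
      qed
    qed
    then have "m dvd h y - h x" by (simp add: A_def coset_def)
    then show "g ^ n dvd h y - h x" unfolding m_def by (rule power_le_dvd) simp
  qed
qed

text \<open>By \<open>radical\<close> for \<open>k\<close>, every prime of \<open>k s\<close>
  divides \<open>k (h f) = f\<close>, so nothing but a power of \<open>f\<close> and a unit
  remains.\<close>

lemma image_prime_power:
  assumes "irreducible f" "s \<noteq> 0" "\<And>p. irreducible p \<Longrightarrow> p dvd s \<Longrightarrow> p dvd h f"
  obtains c n where "c \<noteq> 0" "k s = smult c (f ^ n)"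
proof -
  interpret inv: golomb_homeo k h by (rule inverse_homeo)
  have f0: "f \<noteq> 0" using assms(1) by auto
  have rad: "p dvd f" if "irreducible p" "p dvd k s" for p
    using inv.radical[OF nonzero(1)[OF f0] assms(2)] assms(3) inverse(1)[OF f0] that by auto
  obtain n u where nu: "k s = f ^ n * u" "\<not> f dvd u"
    using irreducible_power_decompose[OF assms(1) nonzero(2)[OF assms(2)]] by blast
  have "u dvd 1"
  proof (rule ccontr)
    assume nu1: "\<not> u dvd 1"
    have "u \<noteq> 0" using nu(2) by auto
    then obtain p where p: "irreducible p" "p dvd u" using irreducible_dvd_exists nu1 by blast
    then have "p dvd f" using rad nu(1) by simp
    then have "f dvd p" using irreducibleD'[OF assms(1)] irreducible_not_unit[OF p(1)] by blast
    then show False using p(2) nu(2) dvd_trans by blast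
  qed
  then obtain c where "c \<noteq> 0" "u = [:c:]" by (rule unit_poly_const)
  then show ?thesis using that[of c n] nu(1) by simp
qed

end

section \<open>Choice of irreducible polynomials\<close>

lemma dirichlet_field_irreducible:
  fixes a r :: "'a::field poly"
  assumes "dirichlet_field TYPE('a)" "a \<noteq> 0" "r \<noteq> 0" "comaximal a r"
  obtains f where "irreducible f" "r dvd f - a"
proof -
  have "a \<in> golomb_space closure_of {p :: 'a poly. irreducible p}"
    using assms(1,2) by (simp add: dirichlet_field_def topspace_golomb_space)
  moreover have "openin golomb_space (coset a r)" "a \<in> coset a r"
    using assms openin_coset by (auto simp: coset_def)
  ultimately obtain f where "irreducible f" "f \<in> coset a r"
    unfolding in_closure_of by blast
  then show ?thesis using that by (simp add: coset_def)
qed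

text \<open>Any prime factor of \<open>q + 1\<close> works; it becomes the auxiliary prime of
  \<open>congruent_const\<close>.\<close>

lemma exists_coprime_irreducible:
  fixes q :: "'a::field poly"
  assumes "irreducible q"
  obtains q' where "irreducible q'" "comaximal q q'"
proof -
  have "degree q > 0"
    using assms by (metis bot_nat_0.not_eq_extremum irreducible_def is_unit_iff_degree)
  then have "degree (q + 1) > 0" by (simp add: degree_add_eq_left)
  then have "q + 1 \<noteq> 0" "\<not> q + 1 dvd 1"
    by (metis degree_0 less_irrefl, metis degree_0 is_unit_iff_degree less_irrefl)
  then obtain q' where q': "irreducible q'" "q' dvd q + 1" using irreducible_dvd_exists by blast
  have "comaximal q (q + 1)"
    unfolding comaximal_def by (rule exI[of _ "-1"], rule exI[of _ 1]) simp
  then show ?thesis using that q' comaximal_dvd_right by blast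
qed

text \<open>The precisions are chosen backwards: \<open>M\<close> at \<open>q\<close>, then
  \<open>m\<close> at \<open>q'\<close>, then \<open>E\<close> at \<open>g'\<close>, which a power
  of the characteristic finally meets.\<close>

lemma (in golomb_homeo) congruent_const:
  assumes dir: "dirichlet_field TYPE('a)" and char: "CHAR('a) > 0"
    and corr: "prime_corr q g" and z: "z \<noteq> 0" and c: "c \<noteq> 0" and qz: "q dvd z - [:c:]"
  shows "g dvd h z - h [:c:]"
proof -
  interpret inv: golomb_homeo k h by (rule inverse_homeo)
  have q: "irreducible q" and g: "irreducible g" using corr unfolding prime_corr_def by blast+
  have unitc: "[:c:] dvd 1" using c by (rule is_unit_triv)
  have not_unit: "\<not> p dvd u" if "irreducible p" "u dvd 1" for p u :: "'a poly"
    using irreducible_not_unit[OF that(1)] that(2) dvd_trans by blast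
  have nqz: "\<not> q dvd z"
  proof
    assume "q dvd z"
    then have "q dvd z - (z - [:c:])" using qz by (rule dvd_diff)
    then show False using not_unit[OF q unitc] by simp
  qed
  obtain q' where q': "irreducible q'" "comaximal q q'" by (rule exists_coprime_irreducible[OF q])
  obtain g' where corr': "prime_corr q' g'" by (rule ex_prime_corr[OF q'(1)])
  have g': "irreducible g'" using corr' unfolding prime_corr_def by blast
  obtain \<delta> where \<delta>: "\<delta> \<noteq> 0" "h [:c:] = [:\<delta>:]" by (rule unit_poly_const[OF unit[OF unitc]])
  \<comment> \<open>\<open>h\<close> need not fix 1, so the preimages of elements close to 1 are
    compared with this constant.\<close>
  obtain \<omega> where \<omega>: "\<omega> \<noteq> 0" "k 1 = [:\<omega>:]" by (rule unit_poly_const[OF inv.unit[OF dvd_refl]])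
  have h\<omega>: "h [:\<omega>:] = 1" using inverse(2)[of 1] \<omega> by simp
  have "[:\<omega>:] \<noteq> 0" "\<not> q dvd [:\<omega>:]" using \<omega>(1) not_unit[OF q] is_unit_triv[of \<omega>] by auto
  from adic_continuity[OF corr this, of 1]
  obtain M where M: "\<forall>t. q ^ M dvd t - [:\<omega>:] \<longrightarrow> g dvd h t - 1"
    unfolding h\<omega> power_one_right by blast
  obtain e1 where e1: "\<forall>y. q ^ e1 dvd y - z \<longrightarrow> g dvd h y - h z"
    using adic_continuity[OF corr z nqz, of 1] unfolding power_one_right by blast
  have "[:c:] \<noteq> 0" "\<not> q' dvd [:c:]" using c not_unit[OF q'(1) unitc] by auto
  from adic_continuity[OF corr' this, of 1]
  obtain e2 where e2: "\<forall>y. q' ^ e2 dvd y - [:c:] \<longrightarrow> g' dvd h y - [:\<delta>:]"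
    unfolding \<delta>(2) power_one_right by blast
  \<comment> \<open>The successors guarantee congruences modulo \<open>q\<close> and
    \<open>q'\<close> themselves.\<close>
  let ?Q = "q ^ Suc e1" and ?Q' = "q' ^ Suc e2"
  have co: "comaximal ?Q ?Q'"
    by (rule comaximal_power_left, subst comaximal_commute, rule comaximal_power_left)
       (use q'(2) comaximal_commute in blast)
  obtain a where a: "?Q dvd a - z" "?Q' dvd a - [:c:]"
    by (rule chinese_remainder_comaximal[OF co])
  have "comaximal a ?Q"
  proof (rule comaximal_add_mult[OF _ a(1)])
    show "comaximal z ?Q"
      by (subst comaximal_commute, rule comaximal_power_left)
         (simp add: irreducible_comaximal_iff[OF q] nqz)
  qed
  moreover have "comaximal a ?Q'"
    by (rule comaximal_add_mult[OF comaximal_unit_left[OF unitc] a(2)])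
  ultimately have aQ: "comaximal a (?Q * ?Q')" by (rule comaximal_mult_right)
  have a0: "a \<noteq> 0"
  proof
    assume "a = 0"
    then have "?Q dvd z" using a(1) by simp
    then show False using nqz by (auto dest: dvd_mult_left)
  qed
  have Q0: "?Q * ?Q' \<noteq> 0" using q q' by auto
  obtain f where f: "irreducible f" "?Q * ?Q' dvd f - a"
    by (rule dirichlet_field_irreducible[OF dir a0 Q0 aQ])
  have "?Q dvd f - a" "?Q' dvd f - a" using f(2) by (rule dvd_mult_left, rule dvd_mult_right)
  then have "?Q dvd (f - a) + (a - z)" "?Q' dvd (f - a) + (a - [:c:])"
    using a dvd_add by blast+
  then have fz: "?Q dvd f - z" and fc': "?Q' dvd f - [:c:]"
    by (simp_all only: diff_add_cancel add_diff_eq)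
  have fz1: "q dvd f - z" "q ^ e1 dvd f - z"
    using fz[unfolded power_Suc] by (rule dvd_mult_left, rule dvd_mult_right)
  have fc1: "q' dvd f - [:c:]" "q' ^ e2 dvd f - [:c:]"
    using fc'[unfolded power_Suc] by (rule dvd_mult_left, rule dvd_mult_right)
  have "q dvd (f - z) + (z - [:c:])" using fz1(1) qz by (rule dvd_add)
  then have fc: "q dvd f - [:c:]" by (simp only: diff_add_cancel add_diff_eq)
  have f0: "f \<noteq> 0" using f by auto
  define y where "y = h f"
  have y0: "y \<noteq> 0" using nonzero(1)[OF f0] by (simp add: y_def)
  have yz: "g dvd y - h z" using e1 fz1(2) unfolding y_def by blast
  have yd: "g' dvd y - [:\<delta>:]" using e2 fc1(2) unfolding y_def by blast

  \<comment> \<open>Since \<open>f\<close> is congruent to \<open>c\<close> modulo both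
    \<open>q\<close> and \<open>q'\<close>, this normalization is congruent to 1 modulo
    both.\<close>
  define t where "t = smult (1 / c) f"
  have t1: "t - 1 = smult (1 / c) (f - [:c:])" using c by (simp add: t_def smult_diff_right one_pCons)
  have "f \<noteq> [:c:]" using irreducible_not_unit[OF f(1)] unitc by auto
  then have "t - 1 \<noteq> 0" unfolding t1 using c by simp
  then have t: "t \<noteq> 1" by auto
  have qt: "q dvd t - 1" unfolding t1 using fc by (rule dvd_smult)
  have q't: "q' dvd t - 1" unfolding t1 using fc1(1) by (rule dvd_smult)
  obtain m where m: "\<forall>n. q' ^ m dvd t ^ n - 1 \<longrightarrow> q ^ M dvd t ^ n - 1"
    using power_near_one_transfer[OF char t qt q'(1) q't] by blast

  have "(1::'a poly) \<noteq> 0" "\<not> g' dvd 1" using irreducible_not_unit[OF g'] by auto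
  from inv.adic_continuity[OF prime_corr_inverse[OF corr'] this, of "Suc m"]
  obtain E where E: "\<forall>s. g' ^ E dvd s - 1 \<longrightarrow> q' ^ Suc m dvd k s - [:\<omega>:]"
    unfolding \<omega>(2) by blast
  let ?P = "CHAR('a) ^ E"
  define v where "v = smult (1 / \<delta>) y"
  \<comment> \<open>By Frobenius, \<open>s - 1\<close> is the \<open>?P\<close>-th power of
    \<open>v - 1\<close>, which \<open>g'\<close> divides; as \<open>E \<le> ?P\<close>, it is
    divisible by \<open>g' ^ E\<close>.\<close>
  define s where "s = v ^ ?P"
  have v1: "v - 1 = smult (1 / \<delta>) (y - [:\<delta>:])" using \<delta>(1) by (simp add: v_def smult_diff_right one_pCons)
  have s1: "s - 1 = (v - 1) ^ ?P" unfolding s_def by (rule power_CHAR_power_minus_one[OF char])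
  have "CHAR('a) > 1" using prime_CHAR_semidom[OF char] prime_gt_1_nat by blast
  then have "E \<le> ?P" by (simp add: less_imp_le)
  then have "g' ^ E dvd g' ^ ?P" by (rule le_imp_power_dvd)
  also have "\<dots> dvd s - 1" unfolding s1 v1 using yd by (intro dvd_power_same dvd_smult)
  finally have ks: "q' ^ Suc m dvd k s - [:\<omega>:]" using E by blast
  have s0: "s \<noteq> 0" using y0 \<delta>(1) by (simp add: s_def v_def)
  have sf: "p dvd h f" if "irreducible p" "p dvd s" for p
  proof -
    have "p dvd v" using irreducible_dvd_power_poly[OF that(1)] that(2) unfolding s_def by blast
    then show ?thesis using \<delta>(1) by (simp add: v_def y_def dvd_smult_iff)
  qed
  obtain b n where b: "b \<noteq> 0" "k s = smult b (f ^ n)"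
    by (rule image_prime_power[OF f(1) s0 sf])
  have "f = smult c t" using c by (simp add: t_def)
  then have ks': "k s = smult (b * c ^ n) (t ^ n)" using b by (simp add: smult_power)
  have "t - 1 dvd t ^ n - 1" by (simp add: power_diff_1_eq)
  then have "q' dvd t ^ n - 1" using q't dvd_trans by blast
  then have "q' dvd smult (b * c ^ n) (t ^ n - 1)" by (rule dvd_smult)
  moreover have "q' dvd k s - [:\<omega>:]" using ks[unfolded power_Suc] by (rule dvd_mult_left)
  ultimately have "q' dvd (k s - [:\<omega>:]) - smult (b * c ^ n) (t ^ n - 1)" by (rule dvd_diff[rotated])
  moreover have "(k s - [:\<omega>:]) - smult (b * c ^ n) (t ^ n - 1) = [:b * c ^ n - \<omega>:]"
    by (simp add: ks' smult_diff_right one_pCons)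
  ultimately have "q' dvd [:b * c ^ n - \<omega>:]" by simp
  \<comment> \<open>A constant divisible by \<open>q'\<close> vanishes. The exponent
    \<open>Suc m\<close> above made this reduction modulo \<open>q'\<close> possible even for
    \<open>m = 0\<close>.\<close>
  then have "b * c ^ n = \<omega>"
    using not_unit[OF q'(1), of "[:b * c ^ n - \<omega>:]"] is_unit_triv[of "b * c ^ n - \<omega>"] by auto
  then have ks1: "k s - [:\<omega>:] = smult \<omega> (t ^ n - 1)"
    by (simp add: ks' smult_diff_right one_pCons)
  have "q' ^ m dvd k s - [:\<omega>:]" using ks by (rule power_le_dvd) simp
  then have "q' ^ m dvd t ^ n - 1" using \<omega>(1) by (simp add: ks1 dvd_smult_iff)
  then have "q ^ M dvd k s - [:\<omega>:]" unfolding ks1 using m by (intro dvd_smult) blast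
  then have "g dvd h (k s) - 1" using M by blast
  then have "g dvd s - 1" by (simp only: inverse(2)[OF s0])
  \<comment> \<open>The prime \<open>g\<close> divides a power of \<open>v - 1\<close>, so the
    Frobenius power can be undone.\<close>
  then have "g dvd v - 1" unfolding s1 by (rule irreducible_dvd_power_poly[OF g])
  then have "g dvd y - [:\<delta>:]" unfolding v1 using \<delta>(1) by (simp add: dvd_smult_iff)
  then have "g dvd (y - [:\<delta>:]) - (y - h z)" using yz by (rule dvd_diff)
  moreover have "(y - [:\<delta>:]) - (y - h z) = h z - h [:c:]" by (simp add: \<delta>(2))
  ultimately show ?thesis by simp
qed

subsection \<open>Evaluation at points of the field\<close>

context golomb_homeo
begin

text \<open>The value \<open>h 0\<close> is unconstrained, 0 not being a point of the space; the
  default makes this a bijection of the field that fixes 0.\<close>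

definition coeff_map :: "'a \<Rightarrow> 'a" where
  "coeff_map c = (if c = 0 then 0 else coeff (h [:c:]) 0)"

lemma h_const:
  assumes "c \<noteq> 0"
  shows "h [:c:] = [:coeff_map c:]"
proof -
  obtain d where "h [:c:] = [:d:]" by (rule unit_poly_const[OF unit[OF is_unit_triv[OF assms]]])
  then show ?thesis using assms by (simp add: coeff_map_def)
qed

lemma coeff_map_nonzero:
  assumes "c \<noteq> 0"
  shows "coeff_map c \<noteq> 0"
proof -
  have "h [:c:] \<noteq> 0" by (rule nonzero(1)) (simp add: assms)
  then show ?thesis by (simp add: h_const[OF assms])
qed

lemma bij_coeff_map: "bij coeff_map"
proof (rule o_bij)
  interpret inv: golomb_homeo k h by (rule inverse_homeo)
  have "inv.coeff_map (coeff_map c) = c" for c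
  proof (cases "c = 0")
    case False
    then have "[:inv.coeff_map (coeff_map c):] = k (h [:c:])"
      by (simp add: h_const inv.h_const coeff_map_nonzero)
    then show ?thesis using False by (simp add: inverse)
  qed (simp add: coeff_map_def inv.coeff_map_def)
  then show "inv.coeff_map \<circ> coeff_map = id" by auto
  have "coeff_map (inv.coeff_map c) = c" for c
  proof (cases "c = 0")
    case False
    then have "[:coeff_map (inv.coeff_map c):] = h (k [:c:])"
      by (simp add: h_const inv.h_const inv.coeff_map_nonzero)
    then show ?thesis using False by (simp add: inverse)
  qed (simp add: coeff_map_def inv.coeff_map_def)
  then show "coeff_map \<circ> inv.coeff_map = id" by auto
qed

text \<open>The constant \<open>poly z a\<close> is the residue of \<open>z\<close> modulo
  \<open>[:- a, 1:]\<close>. If it is nonzero, \<open>congruent_const\<close> applies; if it is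
  zero, the correspondence of primes suffices.\<close>

lemma prime_corr_value:
  assumes dir: "dirichlet_field TYPE('a)" and char: "CHAR('a) > 0"
    and corr: "prime_corr [:- a, 1:] g" and z: "z \<noteq> 0"
  shows "g dvd h z - [:coeff_map (poly z a):]"
proof (cases "poly z a = 0")
  case True
  then have "[:- a, 1:] dvd z" by (simp add: poly_eq_0_iff_dvd)
  then show ?thesis using corr z True by (simp add: prime_corr_def coeff_map_def)
next
  case False
  have "[:- a, 1:] dvd z - [:poly z a:]" by (simp add: poly_eq_0_iff_dvd[symmetric])
  from congruent_const[OF dir char corr z False this] show ?thesis
    by (simp add: h_const False)
qed

text \<open>Constants represent all residues modulo the partner of \<open>[:- a, 1:]\<close>, so it has degree one.\<close>

lemma prime_corr_linear:
  assumes dir: "dirichlet_field TYPE('a)" and char: "CHAR('a) > 0"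
  obtains b where "prime_corr [:- a, 1:] [:- b, 1:]"
proof -
  have irr: "irreducible [:- c, 1:]" for c :: 'a by (rule irreducible_linear_field_poly) simp
  obtain g where g: "prime_corr [:- a, 1:] g" by (rule ex_prime_corr[OF irr])
  have g_irr: "irreducible g" using g by (simp add: prime_corr_def)
  have X: "[:0, 1 :: 'a:] \<noteq> 0" by simp
  \<comment> \<open>For \<open>z = k [:0, 1:]\<close> the image \<open>h z\<close> is the variable
    itself, so its residue modulo \<open>g\<close> is the constant \<open>b\<close>.\<close>
  define b where "b = coeff_map (poly (k [:0, 1:]) a)"
  have "g dvd [:0, 1:] - [:b:]"
    using prime_corr_value[OF dir char g nonzero(2)[OF X]] inverse(2)[OF X] by (simp add: b_def)
  then have gb: "g dvd [:- b, 1:]" by simp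
  then have "[:- b, 1:] dvd g"
    using irreducibleD'[OF irr gb] irreducible_not_unit[OF g_irr] by blast
  then have "g dvd x \<longleftrightarrow> [:- b, 1:] dvd x" for x using gb dvd_trans by blast
  then have "prime_corr [:- a, 1:] [:- b, 1:]" using g irr by (simp add: prime_corr_def)
  then show ?thesis by (rule that)
qed

lemma prime_corr_linear_unique:
  assumes "prime_corr q [:- b, 1:]" "prime_corr q [:- b', 1:]"
  shows "b = b'"
proof -
  have X: "[:- b, 1:] \<noteq> 0" by simp
  have "[:- b, 1:] dvd h (k [:- b, 1:])" by (simp only: inverse(2)[OF X] dvd_refl)
  then have "[:- b', 1:] dvd h (k [:- b, 1:])"
    using assms nonzero(2)[OF X] unfolding prime_corr_def by blast
  then have "[:- b', 1:] dvd [:- b, 1:]" by (simp only: inverse(2)[OF X])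
  then show ?thesis by (simp add: poly_eq_0_iff_dvd[symmetric])
qed

lemma scaled_ring_automorphism:
  assumes dir: "dirichlet_field TYPE('a)" and char: "CHAR('a) > 0"
  shows "\<exists>u \<sigma>. u \<noteq> 0 \<and> ring_automorphism \<sigma> \<and> (\<forall>f. f \<noteq> 0 \<longrightarrow> h f = smult u (\<sigma> f))"
proof -
  interpret inv: golomb_homeo k h by (rule inverse_homeo)
  define \<phi> where "\<phi> a = (SOME b. prime_corr [:- a, 1:] [:- b, 1:])" for a
  have \<phi>: "prime_corr [:- a, 1:] [:- \<phi> a, 1:]" for a
  proof -
    obtain b where "prime_corr [:- a, 1:] [:- b, 1:]" by (rule prime_corr_linear[OF dir char])
    then show ?thesis unfolding \<phi>_def by (rule someI)
  qed
  \<comment> \<open>The inverse homeomorphism supplies a linear partner for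
    \<open>[:- b, 1:]\<close>.\<close>
  have "\<exists>a. b = \<phi> a" for b
  proof -
    obtain a where "inv.prime_corr [:- b, 1:] [:- a, 1:]" by (rule inv.prime_corr_linear[OF dir char])
    then have "prime_corr [:- a, 1:] [:- b, 1:]" by (rule inv.prime_corr_inverse)
    then show ?thesis using prime_corr_linear_unique[OF _ \<phi>] by blast
  qed
  then have surj: "surj \<phi>" by (auto simp: surj_def)
  \<comment> \<open>Extension by 0 to a bijection of the whole polynomial ring, as the conjugation
    lemma requires.\<close>
  define H where "H z = (if z = 0 then 0 else h z)" for z
  have "bij H"
  proof (rule o_bij)
    let ?K = "\<lambda>z. if z = 0 then 0 else k z"
    show "?K \<circ> H = id"
    proof
      fix z show "(?K \<circ> H) z = id z"
        by (cases "z = 0") (simp_all add: H_def nonzero(1) inverse(1))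
    qed
    show "H \<circ> ?K = id"
    proof
      fix z show "(H \<circ> ?K) z = id z"
        by (cases "z = 0") (simp_all add: H_def nonzero(2) inverse(2))
    qed
  qed
  moreover have "poly (H z) (\<phi> a) = coeff_map (poly z a)" for z a
  proof (cases "z = 0")
    case False
    then have "[:- \<phi> a, 1:] dvd h z - [:coeff_map (poly z a):]"
      by (rule prime_corr_value[OF dir char \<phi>])
    then show ?thesis using False by (simp add: poly_eq_0_iff_dvd[symmetric] H_def)
  qed (simp add: H_def coeff_map_def)
  moreover have "coeff_map 0 = 0" by (simp add: coeff_map_def)
  ultimately have "ring_automorphism (\<lambda>z. smult (inverse (coeff_map 1)) (H z))" "coeff_map 1 \<noteq> 0"
    using ring_automorphism_if_poly_bij_conjugate[OF infinite_field surj _ bij_coeff_map] by blast+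
  then show ?thesis
    by (intro exI[of _ "coeff_map 1"] exI[of _ "\<lambda>z. smult (inverse (coeff_map 1)) (H z)"])
       (simp add: H_def)
qed

end

theorem theorem3p9:
  fixes h :: "'a::field poly \<Rightarrow> 'a poly"
  assumes "infinite (UNIV :: 'a set)"
    and "dirichlet_field TYPE('a)"
    and "CHAR('a) > 0"
    and "homeomorphic_map golomb_space golomb_space h"
  shows "\<exists>(u::'a) \<sigma>. u \<noteq> 0 \<and> ring_automorphism \<sigma> \<and>
           (\<forall>f. f \<noteq> 0 \<longrightarrow> h f = smult u (\<sigma> f))"
proof -
  obtain k where "homeomorphic_maps golomb_space golomb_space h k"
    using assms(4) homeomorphic_map_maps by blast
  then interpret golomb_homeo h k
    using assms(1) by unfold_locales
  show ?thesis using assms(2,3) by (rule scaled_ring_automorphism)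
qed

end
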